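(* Any helical surface $X$ (with axis the $z$-axis and pitch $p\neq 0$) with a constant principal curvature ratio $a$, $a\notin\{0,1,-1\}$, is generated as follows. Let $k=\left|\frac{a-1}{a+1}\right|$, let $$g(s)=\frac{(k-1)s^2-(k+1)}{4ks}\sqrt{\frac{2Cs^{k+1}}{s^2+1}},\qquad t(s)=\sqrt{\frac{2Cs^{k+1}}{s^2+1}-1},$$ where $C>0$ is a constant, and let $H(v,\cdot)$ be the helical motion with pitch $1/2$, $$H\big(v,(x_0,y_0,z_0)\big)=\left(x_0\cos v-y_0\sin v,\ x_0\sin v+y_0\cos v,\ z_0+\frac{v}{2}\right).$$ Then $X$ can be parametrized as $$X(v,s)=2p\,H\big(v,X_i(s)\big),\qquad s\in I_C,\ v\in\mathbb{R},\ i=0,1,$$ where $X_i(s)$ is one of the curves $$X_0(s)=\left(\frac{t(s)}{2},\ g(s),\ \int\frac{g'(s)}{t(s)}\,ds\right),\qquad X_1(s)=\left(-\frac{t(s)}{2},\ g(s),\ -\int\frac{g'(s)}{t(s)}\,ds\right),$$ $I_C:=\left\{s:\ s>0,\ \frac{2Cs^{k+1}}{s^2+1}>1\right\}$, and $p$ is the pitch of $X$.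
   Context: A helical motion about the $z$-axis with pitch $p$ maps $(x_0,y_0,z_0)$, for rotation angle $\theta$, to $(x_0\cos\theta-y_0\sin\theta,\ x_0\sin\theta+y_0\cos\theta,\ z_0+p\theta)$. A helical surface in Euclidean $\mathbb{R}^3$ is generated by moving a curve, transversal to the helical paths, under such a motion. A surface has constant principal curvature ratio $a$ if its principal curvatures satisfy $\kappa_1/\kappa_2=a$ with $a$ constant; replacing $a$ by $1/a$ leaves $k$ unchanged. Developable surfaces ($a\in\{0,\infty\}$) and minimal surfaces ($a=-1$) are excluded, and $a=1$ (plane or sphere) does not occur for helical surfaces. The constant $C$ influences the shape of the surface and is always assumed large enough that $I_C$ is nonempty. The integrals denote antiderivatives; their additive constant can be ignored up to a helical motion.
   Formalization: X need only fill a piece of the surface over I_C (for k<1 the curves are singular inside I_C, so a regular X never covers it), and X may contain one helix with t=0, excluded by the strict inequality in I_C, along which the X_0 and X_1 pieces join. *)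

theory Defs
  imports "HOL-Analysis.Analysis"
begin

section \<open>Helical motions and helical surfaces\<close>

definition helical_motion :: "real \<Rightarrow> real \<Rightarrow> real^3 \<Rightarrow> real^3" where
  "helical_motion p \<theta> x =
     vector [x$1 * cos \<theta> - x$2 * sin \<theta>, x$1 * sin \<theta> + x$2 * cos \<theta>, x$3 + p * \<theta>]"

text \<open>The tangent vector at \<open>x\<close> of the helical path through \<open>x\<close>.\<close>

definition helical_velocity :: "real \<Rightarrow> real^3 \<Rightarrow> real^3" where
  "helical_velocity p x = vector_derivative (\<lambda>\<theta>. helical_motion p \<theta> x) (at 0)"

text \<open>A \<open>C\<^sup>2\<close> curve on an open interval which is transversal to the helical paths: its tangent
  vector and the tangent vector of the helical path are linearly independent.\<close>

definition generating_curve :: "real \<Rightarrow> real set \<Rightarrow> (real \<Rightarrow> real^3) \<Rightarrow> bool" where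
  "generating_curve p J c \<longleftrightarrow>
     open J \<and> connected J \<and> J \<noteq> {} \<and>
     c C1_differentiable_on J \<and>
     (\<lambda>u. vector_derivative c (at u)) C1_differentiable_on J \<and>
     (\<forall>u\<in>J. cross3 (vector_derivative c (at u)) (helical_velocity p (c u)) \<noteq> 0)"

definition helical_surface :: "real \<Rightarrow> (real \<Rightarrow> real^3) \<Rightarrow> real \<times> real \<Rightarrow> real^3" where
  "helical_surface p c = (\<lambda>(v, u). helical_motion p v (c u))"


section \<open>Principal curvatures of a parametrized surface\<close>

definition unit_normal :: "(real \<times> real \<Rightarrow> real^3) \<Rightarrow> real \<times> real \<Rightarrow> real^3" where
  "unit_normal X q =
     sgn (cross3 (frechet_derivative X (at q) (1, 0)) (frechet_derivative X (at q) (0, 1)))"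

text \<open>\<open>\<kappa>\<^sub>1\<close> and \<open>\<kappa>\<^sub>2\<close> are the eigenvalues, with multiplicity, of the shape operator
  \<open>- dN \<circ> (dX)\<^sup>-\<^sup>1\<close> of the tangent plane; \<open>\<xi>\<close> and \<open>\<eta>\<close> are the parameter vectors
  of an orthonormal basis of principal directions.\<close>

definition principal_curvatures ::
  "(real \<times> real \<Rightarrow> real^3) \<Rightarrow> real \<times> real \<Rightarrow> real \<Rightarrow> real \<Rightarrow> bool" where
  "principal_curvatures X q \<kappa>\<^sub>1 \<kappa>\<^sub>2 \<longleftrightarrow>
     (\<exists>\<xi> \<eta>. let dX = frechet_derivative X (at q); dN = frechet_derivative (unit_normal X) (at q) in
        norm (dX \<xi>) = 1 \<and> norm (dX \<eta>) = 1 \<and> dX \<xi> \<bullet> dX \<eta> = 0 \<and>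
        - dN \<xi> = \<kappa>\<^sub>1 *\<^sub>R dX \<xi> \<and> - dN \<eta> = \<kappa>\<^sub>2 *\<^sub>R dX \<eta>)"

definition constant_principal_curvature_ratio ::
  "(real \<times> real \<Rightarrow> real^3) \<Rightarrow> (real \<times> real) set \<Rightarrow> real \<Rightarrow> bool" where
  "constant_principal_curvature_ratio X U a \<longleftrightarrow>
     (\<forall>q\<in>U. \<exists>\<kappa>\<^sub>1 \<kappa>\<^sub>2. principal_curvatures X q \<kappa>\<^sub>1 \<kappa>\<^sub>2 \<and> \<kappa>\<^sub>2 \<noteq> 0 \<and> \<kappa>\<^sub>1 / \<kappa>\<^sub>2 = a)"


section \<open>The generating profiles\<close>

definition radicand :: "real \<Rightarrow> real \<Rightarrow> real \<Rightarrow> real" where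
  "radicand k C s = 2 * C * s powr (k + 1) / (s\<^sup>2 + 1)"

definition g_fun :: "real \<Rightarrow> real \<Rightarrow> real \<Rightarrow> real" where
  "g_fun k C s = ((k - 1) * s\<^sup>2 - (k + 1)) / (4 * k * s) * sqrt (radicand k C s)"

definition t_fun :: "real \<Rightarrow> real \<Rightarrow> real \<Rightarrow> real" where
  "t_fun k C s = sqrt (radicand k C s - 1)"

definition I_dom :: "real \<Rightarrow> real \<Rightarrow> real set" where
  "I_dom k C = {s. s > 0 \<and> radicand k C s > 1}"

definition is_profile_antiderivative :: "real \<Rightarrow> real \<Rightarrow> (real \<Rightarrow> real) \<Rightarrow> bool" where
  "is_profile_antiderivative k C Z \<longleftrightarrow>
     (\<forall>s\<in>I_dom k C. (Z has_real_derivative deriv (g_fun k C) s / t_fun k C s) (at s))"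

text \<open>\<open>Z\<close> stands for a choice of the antiderivative of \<open>g' / t\<close>.\<close>

definition profile :: "real \<Rightarrow> real \<Rightarrow> (real \<Rightarrow> real) \<Rightarrow> nat \<Rightarrow> real \<Rightarrow> real^3" where
  "profile k C Z i s =
     (if i = 0 then vector [t_fun k C s / 2, g_fun k C s, Z s]
      else vector [- t_fun k C s / 2, g_fun k C s, - Z s])"

text \<open>The surface \<open>X(v, u) = H\<^sub>p(v, c u)\<close> is parametrized by the helical surfaces
  \<open>(v, s) \<mapsto> 2 p H(v, X\<^sub>i(s))\<close>, \<open>i = 0, 1\<close>, through the parameter change
  \<open>(v, u) \<mapsto> (v + \<phi> u, \<sigma> u)\<close>.

  A generating curve may be an arbitrary piece of a longer one, so \<open>\<sigma>\<close> need not reach all of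
  \<open>I\<^sub>C\<close>. Moreover (for \<open>k < 1\<close>) the profiles \<open>X\<^sub>i\<close> can have a singular point in the interior
  of \<open>I\<^sub>C\<close>, which no regular surface can pass.

  A regular surface may, on the other hand, contain a helix along which the pieces belonging to
  \<open>X\<^sub>0\<close> and \<open>X\<^sub>1\<close> are joined smoothly. There \<open>t = 0\<close>, that is \<open>radicand k C s = 1\<close>, and \<open>s\<close> is an
  end point of \<open>I\<^sub>C\<close> not belonging to \<open>I\<^sub>C\<close>. The set \<open>E\<close> has at most one element, the parameter of
  this helix. Continuity of \<open>i\<close> with values in the discrete space \<open>nat\<close> means that a single
  profile is used on each side of \<open>E\<close>, and continuity of \<open>\<phi>\<close> and \<open>\<sigma>\<close> on all of \<open>J\<close> describes the
  exceptional helix as the limit of the parametrized part.\<close>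

definition parametrized_by_profiles ::
  "real \<Rightarrow> real set \<Rightarrow> (real \<Rightarrow> real^3) \<Rightarrow> real \<Rightarrow> real \<Rightarrow> (nat \<Rightarrow> real \<Rightarrow> real) \<Rightarrow> bool" where
  "parametrized_by_profiles p J c k C Z \<longleftrightarrow>
     (\<exists>\<phi> \<sigma> i E.
        \<phi> C1_differentiable_on J \<and> \<sigma> C1_differentiable_on J \<and>
        E \<subseteq> J \<and> finite E \<and> card E \<le> 1 \<and>
        continuous_on (J - E) i \<and> i ` (J - E) \<subseteq> {0, 1} \<and>
        (\<forall>u\<in>J - E. \<sigma> u \<in> I_dom k C \<and> deriv \<sigma> u \<noteq> 0 \<and>
           (\<forall>v. helical_surface p c (v, u) =
              (2 * p) *\<^sub>R helical_motion (1 / 2) (v + \<phi> u) (profile k C (Z (i u)) (i u) (\<sigma> u)))) \<and>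
        (\<forall>u\<in>E. \<sigma> u > 0 \<and> radicand k C (\<sigma> u) = 1))"

end

theory Submission
  imports Defs
begin

text \<open>
  A normal of a helical surface with pitch \<open>p \<noteq> 0\<close> is never parallel to the axis. Every point of
  the generating curve can therefore be moved, by the motion itself, to a position where the
  normal is orthogonal to the first coordinate axis, that is, where it has a direction
  \<open>(0, -1, T)\<close>. The moved points form the contour of the surface for the projection along the
  first axis. It generates the same surface, and after scaling by \<open>1 / (2 p)\<close> it has the form
  \<open>(T / 2, y, z)\<close> with \<open>dy = T dz\<close>. A derivative of the normal along the contour only involves
  \<open>dT\<close>, so the condition on the principal curvatures is an equation of first order; with
  \<open>w\<^sup>2 = 1 + T\<^sup>2\<close> and \<open>A = w\<^sup>2 dz/dT\<close> it becomes \<open>(A + y)\<^sup>2 + w\<^sup>2 = k\<^sup>2 (A - y)\<^sup>2\<close>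
  (\<open>contour_frame\<close>, \<open>gap_conic\<close>).

  This is a hyperbola with the rational parametrization \<open>2 k (A - y) = w (s + 1 / s)\<close>,
  \<open>2 (A + y) = w (s - 1 / s)\<close>. Solving for \<open>y\<close> gives \<open>y = w ((k - 1) s\<^sup>2 - (k + 1)) / (4 k s)\<close>,
  which is the second coordinate of the profiles (\<open>y_\<sigma>\<close>). Together with \<open>w dy/dw = A\<close> it gives a
  separable equation for \<open>w\<close> and \<open>s\<close> with the integral \<open>w\<^sup>2 = 2 C s\<^bsup>k + 1\<^esup> / (s\<^sup>2 + 1)\<close>
  (\<open>radicand_constant\<close>). Hence \<open>\<bar>T\<bar> = t(s)\<close>, and \<open>dz = dy / T\<close> yields the integral in the third
  coordinate (\<open>height_along_profile\<close>).

  Three points need care. Only one branch of the hyperbola is parametrized by \<open>s > 0\<close>; a solution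
  cannot change the branch, and a half-turn about the axis exchanges the branches
  (\<open>half_turn\<close>). For \<open>k < 1\<close> the map from \<open>s\<close> to \<open>y / w\<close> has a critical point; no solution
  passes it, because \<open>y / w\<close> increases strictly with \<open>\<bar>T\<bar>\<close> and would be maximal there
  (\<open>\<sigma>_regular\<close>). Finally, the Gaussian curvature does not vanish, so \<open>dT \<noteq> 0\<close> and \<open>T\<close> is
  strictly monotone. So \<open>T = 0\<close> on at most one helix, and the two profiles belong to the two
  sides of it.
\<close>


section \<open>Calculus on open intervals\<close>

lemma continuous_antiderivative_interval:
  fixes f :: "real \<Rightarrow> real"
  assumes "open S" "connected S" "continuous_on S f"
  shows "\<exists>F. \<forall>x\<in>S. (F has_real_derivative f x) (at x)"
proof (cases "S = {}")
  case False
  then obtain x0 where x0: "x0 \<in> S" by blast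
  define F where "F = (\<lambda>x. integral {x0..x} f - integral {x..x0} f)"
  have "(F has_real_derivative f x) (at x)" if x: "x \<in> S" for x
  proof -
    obtain e where e: "e > 0" "cball x e \<subseteq> S"
      using assms(1) x open_contains_cball by blast
    define c where "c = min x0 (x - e)"
    define d where "d = max x0 (x + e)"
    have xe: "x - e \<in> S" "x + e \<in> S" using e by (auto simp: dist_real_def subset_iff)
    have cd: "c \<in> S" "d \<in> S" using xe x0 unfolding c_def d_def by (auto simp: min_def max_def)
    have sub: "{c..d} \<subseteq> S"
      using assms(2) cd by (meson connected_contains_Icc)
    have cont: "continuous_on {c..d} f" using assms(3) sub continuous_on_subset by blast
    have int: "f integrable_on {a..b}" if "c \<le> a" "b \<le> d" for a b
      using that cont by (intro integrable_continuous_interval continuous_on_subset[OF cont]) auto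
    have x0cd: "c \<le> x0" "x0 \<le> d" by (auto simp: c_def d_def)
    have xcd: "c < x" "x < d" using e by (auto simp: c_def d_def)
    have F_eq: "F y = integral {c..y} f - integral {c..x0} f" if "y \<in> {c..d}" for y
    proof (cases "x0 \<le> y")
      case True
      have "integral {c..x0} f + integral {x0..y} f = integral {c..y} f"
        using True that x0cd int by (intro Henstock_Kurzweil_Integration.integral_combine) auto
      moreover have "integral {y..x0} f = 0" using True by (cases "x0 = y") auto
      ultimately show ?thesis by (simp add: F_def)
    next
      case False
      have "integral {c..y} f + integral {y..x0} f = integral {c..x0} f"
        using False that x0cd int by (intro Henstock_Kurzweil_Integration.integral_combine) auto
      moreover have "integral {x0..y} f = 0" using False by auto
      ultimately show ?thesis by (simp add: F_def)
    qed
    have "((\<lambda>y. integral {c..y} f) has_real_derivative f x) (at x within {c..d})"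
      using cont xcd by (intro integral_has_real_derivative) auto
    then have "((\<lambda>y. integral {c..y} f - integral {c..x0} f) has_real_derivative f x) (at x)"
      using xcd by (auto simp: at_within_Icc_at intro!: derivative_eq_intros)
    then show ?thesis
      by (rule has_field_derivative_transform_within_open[where S = "{c<..<d}"])
        (use xcd F_eq in auto)
  qed
  then show ?thesis by blast
qed auto

text \<open>The connected components are open, so antiderivatives chosen on each of them can be glued.\<close>

lemma continuous_antiderivative_open:
  fixes f :: "real \<Rightarrow> real"
  assumes "open S" "continuous_on S f"
  shows "\<exists>F. \<forall>x\<in>S. (F has_real_derivative f x) (at x)"
proof -
  let ?K = "connected_component_set S"
  have "\<forall>x. \<exists>F. \<forall>y\<in>?K x. (F has_real_derivative f y) (at y)"
    by (intro allI continuous_antiderivative_interval open_connected_component assms(1)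
        connected_connected_component continuous_on_subset[OF assms(2)] connected_component_subset)
  then have "\<forall>K\<in>range ?K. \<exists>F. \<forall>y\<in>K. (F has_real_derivative f y) (at y)" by auto
  then obtain F where F: "\<forall>K\<in>range ?K. \<forall>y\<in>K. (F K has_real_derivative f y) (at y)"
    by metis
  have "((\<lambda>y. F (?K y) y) has_real_derivative f x) (at x)" if "x \<in> S" for x
  proof (rule has_field_derivative_transform_within_open)
    show "(F (?K x) has_real_derivative f x) (at x)"
      using F that by (metis connected_component_refl mem_Collect_eq rangeI)
    show "open (?K x)" by (simp add: assms(1) open_connected_component)
    show "x \<in> ?K x" using that by (simp add: connected_component_refl)
    show "F (?K x) y = F (?K y) y" if "y \<in> ?K x" for y
      using that by (metis connected_component_eq)
  qed
  then show ?thesis by blast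
qed

lemma zero_derivative_constant_on_interval:
  fixes f :: "real \<Rightarrow> real"
  assumes "connected S" "\<And>x. x \<in> S \<Longrightarrow> (f has_real_derivative 0) (at x)" "x \<in> S" "y \<in> S"
  shows "f x = f y"
proof -
  have "convex S" using assms(1) by (simp add: is_interval_connected_1 is_interval_convex_1[symmetric])
  then have "\<exists>m. \<forall>x\<in>S. f x = m"
    by (rule has_field_derivative_zero_constant) (auto intro: has_field_derivative_at_within assms(2))
  then show ?thesis using assms(3,4) by auto
qed

lemma C1_real_iff:
  fixes f :: "real \<Rightarrow> real"
  shows "f C1_differentiable_on S \<longleftrightarrow>
    (\<exists>f'. (\<forall>x\<in>S. (f has_real_derivative f' x) (at x)) \<and> continuous_on S f')"
  by (simp add: C1_differentiable_on_def has_real_derivative_iff_has_vector_derivative)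

lemma C1_real_comp:
  fixes f g g' :: "real \<Rightarrow> real"
  assumes "f C1_differentiable_on S" "\<And>y. y \<in> f ` S \<Longrightarrow> (g has_real_derivative g' y) (at y)"
    "continuous_on (f ` S) g'"
  shows "(\<lambda>x. g (f x)) C1_differentiable_on S"
proof -
  obtain f' where f': "\<forall>x\<in>S. (f has_real_derivative f' x) (at x)" "continuous_on S f'"
    using assms(1) C1_real_iff by blast
  have "continuous_on S f"
    using assms(1) C1_differentiable_imp_continuous_on by blast
  then have "continuous_on S (\<lambda>x. g' (f x) * f' x)"
    by (intro continuous_on_mult f' continuous_on_compose2[OF assms(3)]) auto
  moreover have "((\<lambda>x. g (f x)) has_real_derivative g' (f x) * f' x) (at x)" if "x \<in> S" for x
    using DERIV_chain2[of g "g' (f x)" f x "f' x"] assms(2) f' that by blast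
  ultimately show ?thesis
    unfolding C1_real_iff by (intro exI[of _ "\<lambda>x. g' (f x) * f' x"] conjI ballI)
qed

lemma C1_inverse:
  fixes f :: "real \<Rightarrow> real"
  assumes "f C1_differentiable_on S" "\<And>x. x \<in> S \<Longrightarrow> f x \<noteq> 0"
  shows "(\<lambda>x. inverse (f x)) C1_differentiable_on S"
proof (rule C1_real_comp[OF assms(1)])
  show "(inverse has_real_derivative - (inverse y ^ Suc (Suc 0))) (at y)" if "y \<in> f ` S" for y
    using that assms(2) by (intro DERIV_inverse) auto
  show "continuous_on (f ` S) (\<lambda>y. - (inverse y ^ Suc (Suc 0)))"
    using assms(2) by (intro continuous_intros) auto
qed

lemma C1_sqrt:
  fixes f :: "real \<Rightarrow> real"
  assumes "f C1_differentiable_on S" "\<And>x. x \<in> S \<Longrightarrow> f x > 0"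
  shows "(\<lambda>x. sqrt (f x)) C1_differentiable_on S"
proof (rule C1_real_comp[OF assms(1)])
  show "(sqrt has_real_derivative inverse (sqrt y) / 2) (at y)" if "y \<in> f ` S" for y
    using that assms(2) by (intro DERIV_real_sqrt) auto
  show "continuous_on (f ` S) (\<lambda>y. inverse (sqrt y) / 2)"
    using assms(2) by (intro continuous_intros) force+
qed

text \<open>A lift of a curve on the unit circle to the angle: \<open>a b' - b a'\<close> is the angular velocity, so
  its antiderivative with the right initial value is the angle. The inner product of the given
  point with the point at that angle is constant, hence 1, and two unit vectors with inner
  product 1 agree.\<close>

lemma C1_angle:
  fixes a b :: "real \<Rightarrow> real"
  assumes J: "open J" "connected J" and C1: "a C1_differentiable_on J" "b C1_differentiable_on J"
    and circle: "\<And>u. u \<in> J \<Longrightarrow> (a u)\<^sup>2 + (b u)\<^sup>2 = 1"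
  shows "\<exists>\<phi>. \<phi> C1_differentiable_on J \<and> (\<forall>u\<in>J. a u = cos (\<phi> u) \<and> b u = sin (\<phi> u))"
proof (cases "J = {}")
  case True
  then show ?thesis by simp
next
  case False
  then obtain u0 where u0: "u0 \<in> J" by blast
  obtain a' where a': "\<And>u. u \<in> J \<Longrightarrow> (a has_real_derivative a' u) (at u)" "continuous_on J a'"
    using C1(1) unfolding C1_real_iff by blast
  obtain b' where b': "\<And>u. u \<in> J \<Longrightarrow> (b has_real_derivative b' u) (at u)" "continuous_on J b'"
    using C1(2) unfolding C1_real_iff by blast
  have cont: "continuous_on J (\<lambda>u. a u * b' u - b u * a' u)"
    by (intro continuous_intros a' b' C1_differentiable_imp_continuous_on C1)
  obtain F where F: "\<And>u. u \<in> J \<Longrightarrow> (F has_real_derivative a u * b' u - b u * a' u) (at u)"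
    using continuous_antiderivative_interval[OF J cont] by blast
  obtain \<theta> where \<theta>: "a u0 = cos \<theta>" "b u0 = sin \<theta>"
    using circle[OF u0] by (metis sincos_total_2pi)
  define \<phi> where "\<phi> u = F u - F u0 + \<theta>" for u
  have \<phi>': "(\<phi> has_real_derivative a u * b' u - b u * a' u) (at u)" if "u \<in> J" for u
    unfolding \<phi>_def by (auto intro!: derivative_eq_intros F that)
  have tangent: "a u * a' u + b u * b' u = 0" if u: "u \<in> J" for u
  proof -
    have "((\<lambda>u. (a u)\<^sup>2 + (b u)\<^sup>2) has_real_derivative 2 * (a u * a' u + b u * b' u)) (at u)"
      by (auto intro!: derivative_eq_intros a' b' u)
    moreover have "((\<lambda>u. (a u)\<^sup>2 + (b u)\<^sup>2) has_real_derivative 0) (at u)"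
      by (rule has_field_derivative_transform_within_open[OF DERIV_const J(1) u, of 1])
        (use circle in auto)
    ultimately show ?thesis using DERIV_unique by force
  qed
  define f where "f u = a u * cos (\<phi> u) + b u * sin (\<phi> u)" for u
  have "(f has_real_derivative 0) (at u)" if u: "u \<in> J" for u
  proof -
    define X where "X = a u * b' u - b u * a' u"
    have "(f has_real_derivative (a' u * cos (\<phi> u) - a u * (sin (\<phi> u) * X))
        + (b' u * sin (\<phi> u) + b u * (cos (\<phi> u) * X))) (at u)"
      unfolding f_def X_def by (auto intro!: derivative_eq_intros a' b' \<phi>' u)
    moreover have "(a' u * cos (\<phi> u) - a u * (sin (\<phi> u) * X))
        + (b' u * sin (\<phi> u) + b u * (cos (\<phi> u) * X)) = 0"
      using circle[OF u] tangent[OF u] unfolding X_def by algebra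
    ultimately show ?thesis by simp
  qed
  then have f_const: "f u = f u0" if "u \<in> J" for u
    using zero_derivative_constant_on_interval J(2) u0 that by blast
  have "f u0 = 1" using \<theta> by (simp add: f_def \<phi>_def flip: power2_eq_square)
  then have f1: "f u = 1" if "u \<in> J" for u using f_const that by metis
  have "(a u - cos (\<phi> u))\<^sup>2 + (b u - sin (\<phi> u))\<^sup>2 = 0" if "u \<in> J" for u
    using f1[OF that] circle[OF that] sin_cos_squared_add[of "\<phi> u"] unfolding f_def
    by (simp add: power2_eq_square algebra_simps)
  then have "a u = cos (\<phi> u) \<and> b u = sin (\<phi> u)" if "u \<in> J" for u
    using that by (simp add: sum_power2_eq_zero_iff)
  moreover have "\<phi> C1_differentiable_on J"
    unfolding C1_real_iff using \<phi>' cont by (intro exI conjI ballI)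
  ultimately show ?thesis by blast
qed

lemma mean_value_on_interval:
  fixes f f' :: "real \<Rightarrow> real"
  assumes S: "connected S" and f: "\<And>x. x \<in> S \<Longrightarrow> (f has_real_derivative f' x) (at x)"
    and ab: "a \<in> S" "b \<in> S" "a \<noteq> b"
  obtains x where "x \<in> S" "(b - a) * (x - a) > 0" "f b - f a = (b - a) * f' x"
proof (cases "a < b")
  case True
  have sub: "{a..b} \<subseteq> S" using S ab(1,2) by (rule connected_contains_Icc)
  obtain x where "a < x" "x < b" "f b - f a = (b - a) * f' x"
    using MVT2[OF True, of f f'] f sub by (metis atLeastAtMost_iff subsetD)
  then show ?thesis using that[of x] sub True by (auto simp: subset_iff)
next
  case False
  then have less: "b < a" using ab by simp
  have sub: "{b..a} \<subseteq> S" using S ab(2,1) by (rule connected_contains_Icc)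
  obtain x where x: "b < x" "x < a" "f a - f b = (a - b) * f' x"
    using MVT2[OF less, of f f'] f sub by (metis atLeastAtMost_iff subsetD)
  then have "f b - f a = (b - a) * f' x" by (simp add: algebra_simps)
  then show ?thesis using that[of x] sub x by (auto simp: subset_iff mult_neg_neg)
qed

lemma nonzero_constant_sign:
  fixes f :: "real \<Rightarrow> real"
  assumes "connected S" "continuous_on S f" "\<And>x. x \<in> S \<Longrightarrow> f x \<noteq> 0"
  shows "(\<forall>x\<in>S. f x > 0) \<or> (\<forall>x\<in>S. f x < 0)"
proof (rule ccontr)
  assume "\<not> ?thesis"
  then obtain a b where "a \<in> S" "f a \<le> 0" "b \<in> S" "f b \<ge> 0" by (meson not_less)
  moreover have "connected (f ` S)" using assms(1,2) connected_continuous_image by blast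
  ultimately have "{f a..f b} \<subseteq> f ` S" by (intro connected_contains_Icc) auto
  then show False using \<open>f a \<le> 0\<close> \<open>f b \<ge> 0\<close> assms(3) by (force simp: subset_iff)
qed

section \<open>Derivatives of a helical surface and of its normal\<close>

lemma vector3_eq_iff: "(x::real^3) = y \<longleftrightarrow> x$1 = y$1 \<and> x$2 = y$2 \<and> x$3 = y$3"
  by (simp add: vec_eq_iff forall_3)

lemma inner_3: "(x::real^3) \<bullet> y = x$1 * y$1 + x$2 * y$2 + x$3 * y$3"
  by (simp add: inner_vec_def sum_3)

lemma has_derivative_vec3:
  fixes f :: "'a::real_normed_vector \<Rightarrow> real^3"
  assumes "\<And>i. ((\<lambda>x. f x $ i) has_derivative (\<lambda>h. f' h $ i)) (at x)"
  shows "(f has_derivative f') (at x)"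
  unfolding has_derivative_componentwise_within[of f f' x UNIV]
  using assms by (auto simp: Basis_vec_def inner_axis)

lemma has_vector_derivative_vec3:
  fixes f :: "real \<Rightarrow> real^3"
  shows "(f has_vector_derivative f') (at x) \<longleftrightarrow>
    (\<forall>i. ((\<lambda>x. f x $ i) has_real_derivative f' $ i) (at x))"
proof
  assume "(f has_vector_derivative f') (at x)"
  then show "\<forall>i. ((\<lambda>x. f x $ i) has_real_derivative f' $ i) (at x)"
    by (auto simp: has_real_derivative_iff_has_vector_derivative
        intro: bounded_linear.has_vector_derivative[OF bounded_linear_vec_nth])
next
  assume "\<forall>i. ((\<lambda>x. f x $ i) has_real_derivative f' $ i) (at x)"
  then show "(f has_vector_derivative f') (at x)"
    unfolding has_vector_derivative_def has_field_derivative_def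
    by (intro has_derivative_vec3) (simp add: mult.commute mult_commute_abs)
qed

lemma helical_motion_components:
  "helical_motion p v x $ 1 = x$1 * cos v - x$2 * sin v"
  "helical_motion p v x $ 2 = x$1 * sin v + x$2 * cos v"
  "helical_motion p v x $ 3 = x$3 + p * v"
  by (simp_all add: helical_motion_def)

lemma helical_velocity_eq: "helical_velocity p x = vector [- x$2, x$1, p]"
proof -
  have "((\<lambda>\<theta>. helical_motion p \<theta> x) has_vector_derivative vector [- x$2, x$1, p]) (at 0)"
    unfolding has_vector_derivative_vec3 forall_3 helical_motion_components
    by (auto intro!: derivative_eq_intros)
  then show ?thesis
    unfolding helical_velocity_def by (rule vector_derivative_at)
qed

text \<open>\<open>helical_motion 0 v\<close> is the rotation through \<open>v\<close> about the axis. As the pitch is arbitrary here,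
  the lemma also differentiates the field of unit normals, which is the helical surface of pitch
  0 generated by the normals along the curve.\<close>

lemma helical_surface_has_derivative:
  assumes "(c has_vector_derivative c') (at u)"
  shows "(helical_surface p c has_derivative
    (\<lambda>(a, b). a *\<^sub>R helical_motion 0 v (helical_velocity p (c u)) + b *\<^sub>R helical_motion 0 v c'))
    (at (v, u))"
proof (rule has_derivative_vec3)
  have c: "((\<lambda>q. c (snd q) $ i) has_derivative (\<lambda>h. c' $ i * snd h)) (at (v, u))"
    for i :: 3
  proof -
    have "((\<lambda>u. c u $ i) has_derivative (\<lambda>h. c' $ i * h)) (at (snd (v, u)))"
      using assms unfolding has_vector_derivative_vec3 has_field_derivative_def by simp
    from has_derivative_compose[OF has_derivative_snd[OF has_derivative_ident] this] show ?thesis .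
  qed
  fix i :: 3
  show "((\<lambda>q. helical_surface p c q $ i) has_derivative
    (\<lambda>h. (case h of (a, b) \<Rightarrow> a *\<^sub>R helical_motion 0 v (helical_velocity p (c u)) +
      b *\<^sub>R helical_motion 0 v c') $ i)) (at (v, u))"
    using exhaust_3[of i] unfolding helical_surface_def case_prod_beta
    by (elim disjE; simp only: helical_motion_components helical_velocity_eq vector_3
        vector_add_component vector_scaleR_component)
      (rule derivative_eq_intros c refl | simp add: fun_eq_iff algebra_simps)+
qed

lemma cross3_rotate:
  "cross3 (helical_motion 0 v x) (helical_motion 0 v y) = helical_motion 0 v (cross3 x y)"
  unfolding vector3_eq_iff
proof (intro conjI)
  show "cross3 (helical_motion 0 v x) (helical_motion 0 v y) $ 3 = helical_motion 0 v (cross3 x y) $ 3"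
    by (simp add: cross3_def helical_motion_components, insert sin_cos_squared_add[of v]) algebra
qed (simp_all add: cross3_def helical_motion_components algebra_simps)

lemma norm_rotate: "norm (helical_motion 0 v x) = norm x"
  unfolding norm_eq_sqrt_inner inner_3
  by (simp add: helical_motion_components, insert sin_cos_squared_add[of v]) algebra

lemma sgn_rotate: "sgn (helical_motion 0 v x) = helical_motion 0 v (sgn x)"
  unfolding vector3_eq_iff
  by (simp add: sgn_div_norm norm_rotate helical_motion_components algebra_simps)

definition curve_normal :: "real \<Rightarrow> (real \<Rightarrow> real^3) \<Rightarrow> real \<Rightarrow> real^3" where
  "curve_normal p c u = cross3 (helical_velocity p (c u)) (vector_derivative c (at u))"

lemma unit_normal_helical_surface:
  assumes "c differentiable at u"
  shows "unit_normal (helical_surface p c) (v, u) = helical_surface 0 (\<lambda>u. sgn (curve_normal p c u)) (v, u)"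
proof -
  have "(c has_vector_derivative vector_derivative c (at u)) (at u)"
    using assms vector_derivative_works by blast
  note d = frechet_derivative_at[OF helical_surface_has_derivative[OF this, where p = p and v = v]]
  show ?thesis
    unfolding unit_normal_def d[symmetric]
    by (simp add: helical_motion_components cross3_rotate sgn_rotate helical_surface_def curve_normal_def)
qed

lemma frechet_derivative_unit_normal:
  assumes J: "open J" "u \<in> J" and c: "\<And>u. u \<in> J \<Longrightarrow> c differentiable at u"
    and n: "((\<lambda>u. sgn (curve_normal p c u)) has_vector_derivative n') (at u)"
  shows "frechet_derivative (unit_normal (helical_surface p c)) (at (v, u)) =
    (\<lambda>(a, b). a *\<^sub>R helical_motion 0 v (helical_velocity 0 (sgn (curve_normal p c u)))
      + b *\<^sub>R helical_motion 0 v n')"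
proof -
  have "(unit_normal (helical_surface p c) has_derivative
    (\<lambda>(a, b). a *\<^sub>R helical_motion 0 v (helical_velocity 0 (sgn (curve_normal p c u)))
      + b *\<^sub>R helical_motion 0 v n')) (at (v, u))"
  proof (rule has_derivative_transform_within_open)
    show "open (UNIV \<times> J)" using J by (simp add: open_Times)
    show "(v, u) \<in> UNIV \<times> J" using J by simp
    show "helical_surface 0 (\<lambda>u. sgn (curve_normal p c u)) q = unit_normal (helical_surface p c) q"
      if "q \<in> UNIV \<times> J" for q
      using that unit_normal_helical_surface[OF c] by (metis mem_Times_iff prod.collapse)
  qed (rule helical_surface_has_derivative[OF n])
  then show ?thesis by (metis frechet_derivative_at)
qed

section \<open>Principal curvatures from an arbitrary parametrization\<close>

text \<open>The vectors \<open>Xv\<close>, \<open>Xu\<close> and \<open>Nv\<close>, \<open>Nu\<close> are the partial derivatives of the surface and of its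
  normal. Passing to a basis of principal directions multiplies \<open>Xv \<times> Xu\<close>, \<open>Nv \<times> Nu\<close> and
  the mixed sum by the same determinant \<open>\<delta>\<close>, and there they can be read off. Thus mean and Gaussian curvature are
  obtained without orthonormalizing the given parametrization.\<close>

lemma principal_curvatures_cross:
  fixes Xv Xu Nv Nu :: "real^3"
  assumes \<xi>: "norm (a1 *\<^sub>R Xv + a2 *\<^sub>R Xu) = 1" and \<eta>: "norm (b1 *\<^sub>R Xv + b2 *\<^sub>R Xu) = 1"
    and orth: "(a1 *\<^sub>R Xv + a2 *\<^sub>R Xu) \<bullet> (b1 *\<^sub>R Xv + b2 *\<^sub>R Xu) = 0"
    and \<kappa>1: "- (a1 *\<^sub>R Nv + a2 *\<^sub>R Nu) = \<kappa>1 *\<^sub>R (a1 *\<^sub>R Xv + a2 *\<^sub>R Xu)"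
    and \<kappa>2: "- (b1 *\<^sub>R Nv + b2 *\<^sub>R Nu) = \<kappa>2 *\<^sub>R (b1 *\<^sub>R Xv + b2 *\<^sub>R Xu)"
  shows "cross3 Xv Nu + cross3 Nv Xu = - (\<kappa>1 + \<kappa>2) *\<^sub>R cross3 Xv Xu"
    and "cross3 Nv Nu = (\<kappa>1 * \<kappa>2) *\<^sub>R cross3 Xv Xu"
proof -
  define \<delta> where "\<delta> = a1 * b2 - a2 * b1"
  define L where "L = (\<lambda>a b. a *\<^sub>R Xv + b *\<^sub>R Xu)"
  define M where "M = (\<lambda>a b. a *\<^sub>R Nv + b *\<^sub>R Nu)"
  have LL: "cross3 (L a1 a2) (L b1 b2) = \<delta> *\<^sub>R cross3 Xv Xu"
    unfolding L_def \<delta>_def vector3_eq_iff by (simp add: cross3_def algebra_simps)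
  have MM: "cross3 (M a1 a2) (M b1 b2) = \<delta> *\<^sub>R cross3 Nv Nu"
    unfolding M_def \<delta>_def vector3_eq_iff by (simp add: cross3_def algebra_simps)
  have LM: "cross3 (L a1 a2) (M b1 b2) + cross3 (M a1 a2) (L b1 b2) =
      \<delta> *\<^sub>R (cross3 Xv Nu + cross3 Nv Xu)"
    unfolding L_def M_def \<delta>_def vector3_eq_iff by (simp add: cross3_def algebra_simps)
  have M: "M a1 a2 = (- \<kappa>1) *\<^sub>R L a1 a2" "M b1 b2 = (- \<kappa>2) *\<^sub>R L b1 b2"
    using \<kappa>1 \<kappa>2 unfolding L_def M_def by (metis minus_minus scaleR_minus_left)+
  have "(norm (cross3 (L a1 a2) (L b1 b2)))\<^sup>2 = 1"
    using norm_cross_dot[of "L a1 a2" "L b1 b2"] \<xi> \<eta> orth by (simp add: L_def)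
  then have "\<delta> \<noteq> 0" using LL by auto
  have "\<delta> *\<^sub>R cross3 Nv Nu = \<delta> *\<^sub>R ((\<kappa>1 * \<kappa>2) *\<^sub>R cross3 Xv Xu)"
    using MM LL by (simp add: M cross_mult_left cross_mult_right mult_ac)
  with \<open>\<delta> \<noteq> 0\<close> show "cross3 Nv Nu = (\<kappa>1 * \<kappa>2) *\<^sub>R cross3 Xv Xu"
    by (blast intro: real_vector.scale_left_imp_eq)
  have "\<delta> *\<^sub>R (cross3 Xv Nu + cross3 Nv Xu) = (- \<kappa>2 - \<kappa>1) *\<^sub>R cross3 (L a1 a2) (L b1 b2)"
    unfolding LM[symmetric]
    by (simp add: M(1) M(2) cross_mult_left cross_mult_right scaleR_left_diff_distrib)
  also have "\<dots> = \<delta> *\<^sub>R (- (\<kappa>1 + \<kappa>2) *\<^sub>R cross3 Xv Xu)"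
    unfolding LL by (simp add: algebra_simps)
  finally show "cross3 Xv Nu + cross3 Nv Xu = - (\<kappa>1 + \<kappa>2) *\<^sub>R cross3 Xv Xu"
    using \<open>\<delta> \<noteq> 0\<close> by (blast intro: real_vector.scale_left_imp_eq)
qed

lemma principal_curvatures_imp_cross:
  assumes "principal_curvatures X q \<kappa>1 \<kappa>2"
    and dX: "frechet_derivative X (at q) = (\<lambda>(a, b). a *\<^sub>R Xv + b *\<^sub>R Xu)"
    and dN: "frechet_derivative (unit_normal X) (at q) = (\<lambda>(a, b). a *\<^sub>R Nv + b *\<^sub>R Nu)"
  shows "cross3 Xv Nu + cross3 Nv Xu = - (\<kappa>1 + \<kappa>2) *\<^sub>R cross3 Xv Xu"
    and "cross3 Nv Nu = (\<kappa>1 * \<kappa>2) *\<^sub>R cross3 Xv Xu"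
proof -
  obtain a1 a2 b1 b2 where ab:
    "norm (a1 *\<^sub>R Xv + a2 *\<^sub>R Xu) = 1" "norm (b1 *\<^sub>R Xv + b2 *\<^sub>R Xu) = 1"
    "(a1 *\<^sub>R Xv + a2 *\<^sub>R Xu) \<bullet> (b1 *\<^sub>R Xv + b2 *\<^sub>R Xu) = 0"
    "- (a1 *\<^sub>R Nv + a2 *\<^sub>R Nu) = \<kappa>1 *\<^sub>R (a1 *\<^sub>R Xv + a2 *\<^sub>R Xu)"
    "- (b1 *\<^sub>R Nv + b2 *\<^sub>R Nu) = \<kappa>2 *\<^sub>R (b1 *\<^sub>R Xv + b2 *\<^sub>R Xu)"
    using assms(1) unfolding principal_curvatures_def Let_def dX dN by auto
  show "cross3 Xv Nu + cross3 Nv Xu = - (\<kappa>1 + \<kappa>2) *\<^sub>R cross3 Xv Xu"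
    "cross3 Nv Nu = (\<kappa>1 * \<kappa>2) *\<^sub>R cross3 Xv Xu"
    using principal_curvatures_cross[OF ab] by blast+
qed

text \<open>With \<open>\<kappa>1 = a \<kappa>2\<close> the identity \<open>(1 - k\<^sup>2) (\<kappa>1 + \<kappa>2)\<^sup>2 = 4 \<kappa>1 \<kappa>2\<close> holds, because \<open>k\<close> is the
  absolute value of \<open>(\<kappa>1 - \<kappa>2) / (\<kappa>1 + \<kappa>2)\<close>. The cross products are the multiples of
  \<open>Xv \<times> Xu\<close> by \<open>- (\<kappa>1 + \<kappa>2)\<close> and \<open>\<kappa>1 \<kappa>2\<close>, so they may be tested against any vector \<open>m\<close> that is
  not tangent to the surface, such as a normal of arbitrary length.\<close>

lemma curvature_ratio_relation:
  assumes X: "constant_principal_curvature_ratio X U a" "q \<in> U"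
    and a: "a \<noteq> 0" "a \<noteq> - 1" and k: "k = \<bar>(a - 1) / (a + 1)\<bar>"
    and dX: "frechet_derivative X (at q) = (\<lambda>(a, b). a *\<^sub>R Xv + b *\<^sub>R Xu)"
    and dN: "frechet_derivative (unit_normal X) (at q) = (\<lambda>(a, b). a *\<^sub>R Nv + b *\<^sub>R Nu)"
    and m: "m \<bullet> cross3 Xv Xu \<noteq> 0"
  shows "(1 - k\<^sup>2) * (m \<bullet> (cross3 Xv Nu + cross3 Nv Xu))\<^sup>2
      = 4 * (m \<bullet> cross3 Nv Nu) * (m \<bullet> cross3 Xv Xu)"
    and "m \<bullet> cross3 Nv Nu \<noteq> 0"
proof -
  obtain \<kappa>1 \<kappa>2 where pc: "principal_curvatures X q \<kappa>1 \<kappa>2" and "\<kappa>2 \<noteq> 0" "\<kappa>1 / \<kappa>2 = a"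
    using X unfolding constant_principal_curvature_ratio_def by blast
  then have \<kappa>1: "\<kappa>1 = a * \<kappa>2" by (simp add: field_simps)
  define D where "D = m \<bullet> cross3 Xv Xu"
  have mixed: "m \<bullet> (cross3 Xv Nu + cross3 Nv Xu) = - ((a + 1) * \<kappa>2 * D)"
    unfolding principal_curvatures_imp_cross(1)[OF pc dX dN] D_def \<kappa>1
    by (simp add: algebra_simps)
  have G: "m \<bullet> cross3 Nv Nu = a * \<kappa>2\<^sup>2 * D"
    unfolding principal_curvatures_imp_cross(2)[OF pc dX dN] D_def \<kappa>1
    by (simp add: power2_eq_square)
  show "m \<bullet> cross3 Nv Nu \<noteq> 0" unfolding G using a \<open>\<kappa>2 \<noteq> 0\<close> m by (simp add: D_def)
  have "k\<^sup>2 * (a + 1)\<^sup>2 = (a - 1)\<^sup>2"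
    using a k by (simp add: power_divide)
  then have k: "(1 - k\<^sup>2) * (a + 1)\<^sup>2 = 4 * a" by algebra
  have "(1 - k\<^sup>2) * (- ((a + 1) * \<kappa>2 * D))\<^sup>2 = ((1 - k\<^sup>2) * (a + 1)\<^sup>2) * (\<kappa>2 * D)\<^sup>2" by algebra
  also have "\<dots> = 4 * (a * \<kappa>2\<^sup>2 * D) * D" unfolding k by algebra
  finally show "(1 - k\<^sup>2) * (m \<bullet> (cross3 Xv Nu + cross3 Nv Xu))\<^sup>2
      = 4 * (m \<bullet> cross3 Nv Nu) * (m \<bullet> cross3 Xv Xu)"
    unfolding mixed G D_def .
qed

section \<open>The contour of a helical surface\<close>

text \<open>The equations of a contour \<open>(T / 2, y, z)\<close> with normals \<open>(0, -1, T)\<close>. Tangency is expressed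
  by the derivative \<open>T z'\<close> of \<open>y\<close>. The last condition is the relation \<open>(1 - k\<^sup>2) H\<^sup>2 = K\<close> between
  mean and Gaussian curvature, freed from denominators, and \<open>T' \<noteq> 0\<close> says that \<open>K\<close> does not
  vanish.\<close>

locale contour_ode =
  fixes k :: real and J :: "real set" and T y z T' z' :: "real \<Rightarrow> real"
  assumes open_J: "open J" and connected_J: "connected J"
    and T_deriv: "\<And>u. u \<in> J \<Longrightarrow> (T has_real_derivative T' u) (at u)"
    and y_deriv: "\<And>u. u \<in> J \<Longrightarrow> (y has_real_derivative T u * z' u) (at u)"
    and z_deriv: "\<And>u. u \<in> J \<Longrightarrow> (z has_real_derivative z' u) (at u)"
    and T'_cont: "continuous_on J T'" and z'_cont: "continuous_on J z'"
    and T'_nz: "\<And>u. u \<in> J \<Longrightarrow> T' u \<noteq> 0"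
    and curvature: "\<And>u. u \<in> J \<Longrightarrow> (1 - k\<^sup>2) * ((1 + (T u)\<^sup>2) * z' u - T' u * y u)\<^sup>2
      = - (T' u * (1 + (T u)\<^sup>2) * (T' u + 4 * y u * z' u))"

text \<open>The partial derivatives of the surface and of its unit normal, in the coordinates in which
  the normal is \<open>\<rho> (0, -1, T)\<close>. The terms with \<open>\<phi>'\<close> (from the motion that carries the
  generating curve to the contour) and with \<open>\<rho>'\<close> (from the normalization) drop out of all three
  products, and only first derivatives of the contour remain.\<close>

lemma contour_forms:
  fixes x y T \<rho> \<rho>' x' y' z' T' \<phi>' p :: real
  defines "Xv \<equiv> vector [- (2 * p * y), 2 * p * x, p] :: real^3"
    and "Xu \<equiv> vector [2 * p * (x' - \<phi>' * y), 2 * p * (y' + \<phi>' * x), 2 * p * (z' + \<phi>' / 2)] :: real^3"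
    and "Nv \<equiv> vector [\<rho>, 0, 0] :: real^3"
    and "Nu \<equiv> vector [\<rho> * \<phi>', - \<rho>', \<rho> * T' + \<rho>' * T] :: real^3"
    and "m \<equiv> vector [0, - 1, T] :: real^3"
  assumes x: "x = T / 2" "x' = T' / 2" and y': "y' = T * z'"
  shows "m \<bullet> (cross3 Xv Nu + cross3 Nv Xu) = 2 * p * \<rho> * ((1 + T\<^sup>2) * z' - T' * y)"
    and "m \<bullet> cross3 Nv Nu = \<rho>\<^sup>2 * T'"
    and "m \<bullet> cross3 Xv Xu = - (p\<^sup>2 * (1 + T\<^sup>2) * (T' + 4 * y * z'))"
proof -
  show "m \<bullet> cross3 Nv Nu = \<rho>\<^sup>2 * T'"
    unfolding assms(3-5) by (simp add: inner_3 cross3_def) algebra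
  show "m \<bullet> cross3 Xv Xu = - (p\<^sup>2 * (1 + T\<^sup>2) * (T' + 4 * y * z'))"
    unfolding assms(1-5) x y' by (simp add: inner_3 cross3_def field_simps power2_eq_square)
  show "m \<bullet> (cross3 Xv Nu + cross3 Nv Xu) = 2 * p * \<rho> * ((1 + T\<^sup>2) * z' - T' * y)"
    unfolding assms(1-5) x y' by (simp add: inner_3 cross3_def field_simps power2_eq_square)
qed

lemma C1_vec_nth:
  fixes c :: "real \<Rightarrow> real^3"
  assumes "c C1_differentiable_on J"
  shows "(\<lambda>u. c u $ i) C1_differentiable_on J"
proof -
  obtain D where D: "\<forall>u\<in>J. (c has_vector_derivative D u) (at u)" "continuous_on J D"
    using assms unfolding C1_differentiable_on_def by blast
  show ?thesis
    unfolding C1_differentiable_on_def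
    by (intro exI[of _ "\<lambda>u. D u $ i"] conjI ballI continuous_on_component D(2)
        bounded_linear.has_vector_derivative[OF bounded_linear_vec_nth] D(1)[rule_format])
qed

text \<open>The moved and rescaled curve is the locus where the normal is orthogonal to the first
  coordinate axis. That a normal \<open>(0, -1, T)\<close> is orthogonal to the helical path gives the first
  coordinate \<open>T / 2\<close>, and that it is orthogonal to the curve gives \<open>y' = T z'\<close>. The curvature
  condition at \<open>c u\<close> is evaluated at the parameter \<open>(- \<phi> u, u)\<close> of the surface, where the
  normal has this special position already.\<close>

lemma contour_frame:
  assumes p: "p \<noteq> 0" and a: "a \<noteq> 0" "a \<noteq> - 1" and gc: "generating_curve p J c"
    and ratio: "constant_principal_curvature_ratio (helical_surface p c) (UNIV \<times> J) a"
    and k: "k = \<bar>(a - 1) / (a + 1)\<bar>"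
  obtains \<phi> T y z T' z' where "\<phi> C1_differentiable_on J" "contour_ode k J T y z T' z'"
    "\<And>u. u \<in> J \<Longrightarrow>
      c u = (2 * p) *\<^sub>R helical_motion (1 / 2) (\<phi> u) (vector [T u / 2, y u, z u])"
proof -
  define d where "d u = vector_derivative c (at u)" for u
  have J: "open J" "connected J" and c_C1: "c C1_differentiable_on J" and d_C1: "d C1_differentiable_on J"
    and transversal: "\<And>u. u \<in> J \<Longrightarrow> cross3 (d u) (helical_velocity p (c u)) \<noteq> 0"
    using gc unfolding generating_curve_def d_def by auto
  have c_diff: "c differentiable at u" if "u \<in> J" for u
    using c_C1 that unfolding C1_differentiable_on_eq by blast
  have c_deriv: "(c has_vector_derivative d u) (at u)" if "u \<in> J" for u
    using c_diff[OF that] unfolding d_def by (simp add: vector_derivative_works)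
  note c_deriv_nth = c_deriv[unfolded has_vector_derivative_vec3, rule_format]
  define m where "m = curve_normal p c"
  have m: "m u $ 1 = c u $ 1 * d u $ 3 - p * d u $ 2" "m u $ 2 = p * d u $ 1 + c u $ 2 * d u $ 3"
    "m u $ 3 = - (c u $ 2 * d u $ 2) - c u $ 1 * d u $ 1" for u
    by (simp_all add: m_def curve_normal_def helical_velocity_eq cross3_def d_def)
  have m_C1: "(\<lambda>u. m u $ i) C1_differentiable_on J" for i
    using exhaust_3[of i] unfolding m
    by (elim disjE; simp only: m; intro C1_differentiable_on_diff C1_differentiable_on_add
        C1_differentiable_on_minus C1_differentiable_on_mult C1_differentiable_on_const
        C1_vec_nth c_C1 d_C1)
  have m_perp: "m u $ 3 * p = m u $ 1 * c u $ 2 - m u $ 2 * c u $ 1"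
    "m u $ 1 * d u $ 1 + m u $ 2 * d u $ 2 + m u $ 3 * d u $ 3 = 0" for u
    unfolding m by algebra+
  define r where "r u = sqrt ((m u $ 1)\<^sup>2 + (m u $ 2)\<^sup>2)" for u
  \<comment> \<open>The normal is never parallel to the axis, since the velocity of the motion has the
    component \<open>p \<noteq> 0\<close> along the axis.\<close>
  have horizontal: "(m u $ 1)\<^sup>2 + (m u $ 2)\<^sup>2 > 0" if "u \<in> J" for u
  proof -
    have "m u \<noteq> 0"
      using transversal[OF that] unfolding m_def curve_normal_def d_def
      by (metis cross_skew neg_equal_0_iff_equal)
    then have "m u $ 1 \<noteq> 0 \<or> m u $ 2 \<noteq> 0"
      using m_perp(1)[of u] p by (auto simp: vector3_eq_iff)
    then show ?thesis by (simp add: sum_power2_gt_zero_iff)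
  qed
  have r_pos: "r u > 0" if "u \<in> J" for u using horizontal[OF that] by (simp add: r_def)
  have r_sq: "(r u)\<^sup>2 = (m u $ 1)\<^sup>2 + (m u $ 2)\<^sup>2" for u by (simp add: r_def)
  have "(\<lambda>u. (m u $ 1)\<^sup>2 + (m u $ 2)\<^sup>2) C1_differentiable_on J"
    unfolding power2_eq_square by (intro C1_differentiable_on_add C1_differentiable_on_mult m_C1)
  then have r_C1: "r C1_differentiable_on J"
    unfolding r_def using horizontal by (rule C1_sqrt)
  have inv_r_C1: "(\<lambda>u. inverse (r u)) C1_differentiable_on J"
    using r_C1 r_pos by (intro C1_inverse) force+
  define T where "T u = m u $ 3 * inverse (r u)" for u
  have T_C1: "T C1_differentiable_on J"
    unfolding T_def by (intro C1_differentiable_on_mult m_C1 inv_r_C1)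
  have "(\<lambda>u. - (m u $ 2) * inverse (r u)) C1_differentiable_on J"
    by (intro C1_differentiable_on_mult C1_differentiable_on_minus m_C1 inv_r_C1)
  moreover have "(\<lambda>u. m u $ 1 * inverse (r u)) C1_differentiable_on J"
    by (intro C1_differentiable_on_mult m_C1 inv_r_C1)
  moreover have "(- (m u $ 2) * inverse (r u))\<^sup>2 + (m u $ 1 * inverse (r u))\<^sup>2 = 1"
    if "u \<in> J" for u
  proof -
    have "r u * inverse (r u) = 1" using r_pos[OF that] by simp
    then show ?thesis using r_sq[of u] by algebra
  qed
  ultimately have "\<exists>\<phi>. \<phi> C1_differentiable_on J \<and>
      (\<forall>u\<in>J. - (m u $ 2) * inverse (r u) = cos (\<phi> u) \<and> m u $ 1 * inverse (r u) = sin (\<phi> u))"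
    by (rule C1_angle[OF J])
  then obtain \<phi> where \<phi>_C1: "\<phi> C1_differentiable_on J"
    and cos_\<phi>: "\<And>u. u \<in> J \<Longrightarrow> - (m u $ 2) * inverse (r u) = cos (\<phi> u)"
    and sin_\<phi>: "\<And>u. u \<in> J \<Longrightarrow> m u $ 1 * inverse (r u) = sin (\<phi> u)"
    by blast
  have m_polar: "m u $ 1 = r u * sin (\<phi> u)" "m u $ 2 = - (r u * cos (\<phi> u))" "m u $ 3 = r u * T u"
    if "u \<in> J" for u
    using r_pos[OF that] cos_\<phi>[OF that] sin_\<phi>[OF that] by (simp_all add: T_def field_simps)
  obtain T' where T': "\<And>u. u \<in> J \<Longrightarrow> (T has_real_derivative T' u) (at u)" "continuous_on J T'"
    using T_C1 unfolding C1_real_iff by blast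
  obtain \<phi>' where \<phi>': "\<And>u. u \<in> J \<Longrightarrow> (\<phi> has_real_derivative \<phi>' u) (at u)" "continuous_on J \<phi>'"
    using \<phi>_C1 unfolding C1_real_iff by blast
  define \<rho> where "\<rho> u = inverse (sqrt (1 + (T u)\<^sup>2))" for u
  have w_pos: "1 + (T u)\<^sup>2 > 0" for u by (simp add: add_pos_nonneg)
  have "\<rho> C1_differentiable_on J"
    unfolding \<rho>_def
  proof (intro C1_inverse C1_sqrt)
    show "(\<lambda>u. 1 + (T u)\<^sup>2) C1_differentiable_on J"
      unfolding power2_eq_square
      by (intro C1_differentiable_on_add C1_differentiable_on_mult C1_differentiable_on_const T_C1)
  qed (use w_pos in \<open>auto simp: less_imp_neq[symmetric]\<close>)
  then obtain \<rho>' where \<rho>': "\<And>u. u \<in> J \<Longrightarrow> (\<rho> has_real_derivative \<rho>' u) (at u)"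
    unfolding C1_real_iff by blast
  have \<rho>_pos: "\<rho> u > 0" for u using w_pos[of u] by (simp add: \<rho>_def)
  define n where "n = (\<lambda>u. sgn (curve_normal p c u))"
  have n: "n u = vector [\<rho> u * sin (\<phi> u), - (\<rho> u * cos (\<phi> u)), \<rho> u * T u]" if "u \<in> J" for u
  proof -
    have "(norm (m u))\<^sup>2 = (r u)\<^sup>2 * (1 + (T u)\<^sup>2)"
      unfolding power2_norm_eq_inner inner_3 m_polar[OF that]
      using sin_cos_squared_add[of "\<phi> u"] by algebra
    then have "(norm (m u))\<^sup>2 = (r u * sqrt (1 + (T u)\<^sup>2))\<^sup>2"
      using w_pos[of u] by (simp add: power_mult_distrib)
    then have "norm (m u) = r u * sqrt (1 + (T u)\<^sup>2)"
      by (rule power2_eq_imp_eq) (use r_pos[OF that] w_pos[of u] in simp_all)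
    then show ?thesis
      using r_pos[OF that] unfolding n_def m_def[symmetric] sgn_div_norm vector3_eq_iff
      by (simp add: m_polar[OF that] \<rho>_def field_simps)
  qed
  define n' where "n' u = (vector [\<rho> u * \<phi>' u * cos (\<phi> u) + \<rho>' u * sin (\<phi> u),
    \<rho> u * \<phi>' u * sin (\<phi> u) - \<rho>' u * cos (\<phi> u), \<rho> u * T' u + \<rho>' u * T u] :: real^3)" for u
  have n': "(n has_vector_derivative n' u) (at u)" if "u \<in> J" for u
  proof (rule has_vector_derivative_transform_within_open[OF _ J(1) that])
    show "((\<lambda>u. vector [\<rho> u * sin (\<phi> u), - (\<rho> u * cos (\<phi> u)), \<rho> u * T u] :: real^3)
      has_vector_derivative n' u) (at u)"
      unfolding has_vector_derivative_vec3 forall_3 n'_def vector_3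
      by (auto intro!: derivative_eq_intros \<rho>' \<phi>' T' that)
  qed (simp add: n)
  define x where "x u = (c u $ 1 * cos (\<phi> u) + c u $ 2 * sin (\<phi> u)) / (2 * p)" for u
  define y where "y u = (c u $ 2 * cos (\<phi> u) - c u $ 1 * sin (\<phi> u)) / (2 * p)" for u
  define z where "z u = c u $ 3 / (2 * p) - \<phi> u / 2" for u
  define y' where "y' u = (d u $ 2 * cos (\<phi> u) - d u $ 1 * sin (\<phi> u)) / (2 * p) - \<phi>' u * x u" for u
  define z' where "z' u = d u $ 3 / (2 * p) - \<phi>' u / 2" for u
  have x_eq: "x u = T u / 2" if "u \<in> J" for u
  proof -
    have "r u * (T u * p) = r u * (sin (\<phi> u) * c u $ 2 + cos (\<phi> u) * c u $ 1)"
      using m_perp(1)[of u] unfolding m_polar[OF that] by algebra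
    then have "T u * p = sin (\<phi> u) * c u $ 2 + cos (\<phi> u) * c u $ 1"
      using r_pos[OF that] by simp
    then show ?thesis using p by (simp add: x_def field_simps)
  qed
  have x_deriv: "(x has_real_derivative
      (d u $ 1 * cos (\<phi> u) + d u $ 2 * sin (\<phi> u)) / (2 * p) + \<phi>' u * y u) (at u)" if "u \<in> J" for u
    unfolding x_def y_def
    by (rule DERIV_cong, rule DERIV_cdivide,
        (rule derivative_eq_intros c_deriv_nth[OF that] \<phi>'(1)[OF that] refl)+)
      (use p in \<open>simp add: field_simps\<close>)
  have x': "(d u $ 1 * cos (\<phi> u) + d u $ 2 * sin (\<phi> u)) / (2 * p) + \<phi>' u * y u = T' u / 2"
    if "u \<in> J" for u
  proof (rule DERIV_unique[OF x_deriv[OF that]])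
    show "(x has_real_derivative T' u / 2) (at u)"
      by (rule has_field_derivative_transform_within_open[OF _ J(1) that, of "\<lambda>u. T u / 2"])
        (auto intro!: derivative_eq_intros T' that simp: x_eq)
  qed
  have y_deriv: "(y has_real_derivative y' u) (at u)" if "u \<in> J" for u
    unfolding y_def y'_def x_def
    by (rule DERIV_cong, rule DERIV_cdivide,
        (rule derivative_eq_intros c_deriv_nth[OF that] \<phi>'(1)[OF that] refl)+)
      (use p in \<open>simp add: field_simps\<close>)
  have z_deriv: "(z has_real_derivative z' u) (at u)" if "u \<in> J" for u
    unfolding z_def z'_def
    by (intro DERIV_diff DERIV_cdivide c_deriv_nth[OF that] \<phi>'(1)[OF that])
  have y'_eq: "y' u = T u * z' u" if "u \<in> J" for u
  proof -
    have "r u * (d u $ 2 * cos (\<phi> u) - d u $ 1 * sin (\<phi> u)) = r u * (T u * d u $ 3)"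
      using m_perp(2)[of u] unfolding m_polar[OF that] by algebra
    then have "d u $ 2 * cos (\<phi> u) - d u $ 1 * sin (\<phi> u) = T u * d u $ 3"
      using r_pos[OF that] by simp
    then show ?thesis
      unfolding y'_def z'_def x_eq[OF that] by (simp add: right_diff_distrib)
  qed
  have curv: "T' u \<noteq> 0 \<and> (1 - k\<^sup>2) * ((1 + (T u)\<^sup>2) * z' u - T' u * y u)\<^sup>2
      = - (T' u * (1 + (T u)\<^sup>2) * (T' u + 4 * y u * z' u))" if u: "u \<in> J" for u
  proof -
    let ?R = "helical_motion 0 (- \<phi> u)"
    let ?M = "vector [0, - 1, T u] :: real^3"
    have Xv: "?R (helical_velocity p (c u)) = vector [- (2 * p * y u), 2 * p * x u, p]"
      using p unfolding vector3_eq_iff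
      by (simp add: helical_motion_components helical_velocity_eq x_def y_def field_simps)
    have "2 * p * (T' u / 2 - \<phi>' u * y u) = d u $ 1 * cos (\<phi> u) + d u $ 2 * sin (\<phi> u)"
      unfolding x'[OF u, symmetric] using p by (simp add: field_simps)
    moreover have "2 * p * (y' u + \<phi>' u * x u) = d u $ 2 * cos (\<phi> u) - d u $ 1 * sin (\<phi> u)"
      unfolding y'_def using p by (simp add: field_simps)
    moreover have "2 * p * (z' u + \<phi>' u / 2) = d u $ 3"
      unfolding z'_def using p by (simp add: field_simps)
    ultimately have Xu: "?R (d u) = vector [2 * p * (T' u / 2 - \<phi>' u * y u),
        2 * p * (y' u + \<phi>' u * x u), 2 * p * (z' u + \<phi>' u / 2)]"
      unfolding vector3_eq_iff by (simp add: helical_motion_components)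
    have Nv: "?R (helical_velocity 0 (n u)) = vector [\<rho> u, 0, 0]"
      unfolding vector3_eq_iff
      by (simp add: helical_motion_components helical_velocity_eq n[OF u],
          insert sin_cos_squared_add[of "\<phi> u"]) algebra
    have Nu: "?R (n' u) = vector [\<rho> u * \<phi>' u, - \<rho>' u, \<rho> u * T' u + \<rho>' u * T u]"
      unfolding vector3_eq_iff
      by (simp add: helical_motion_components n'_def, insert sin_cos_squared_add[of "\<phi> u"])
        (intro conjI; algebra)
    have Rm: "?R (m u) = vector [0, - r u, r u * T u]"
      unfolding vector3_eq_iff
      by (simp add: helical_motion_components m_polar[OF u], insert sin_cos_squared_add[of "\<phi> u"])
        algebra
    have "cross3 (?R (helical_velocity p (c u))) (?R (d u)) = ?R (m u)"
      unfolding cross3_rotate m_def curve_normal_def d_def ..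
    then have "?M \<bullet> cross3 (?R (helical_velocity p (c u))) (?R (d u)) = r u * (1 + (T u)\<^sup>2)"
      by (simp add: Rm inner_3 algebra_simps power2_eq_square)
    then have nz: "?M \<bullet> cross3 (?R (helical_velocity p (c u))) (?R (d u)) \<noteq> 0"
      using r_pos[OF u] w_pos[of u] by simp
    have q: "(- \<phi> u, u) \<in> UNIV \<times> J" using u by simp
    have dX: "frechet_derivative (helical_surface p c) (at (- \<phi> u, u)) =
        (\<lambda>(a, b). a *\<^sub>R ?R (helical_velocity p (c u)) + b *\<^sub>R ?R (d u))"
      using frechet_derivative_at[OF helical_surface_has_derivative[OF c_deriv[OF u]]] by metis
    have dN: "frechet_derivative (unit_normal (helical_surface p c)) (at (- \<phi> u, u)) =
        (\<lambda>(a, b). a *\<^sub>R ?R (helical_velocity 0 (n u)) + b *\<^sub>R ?R (n' u))"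
      using frechet_derivative_unit_normal[OF J(1) u c_diff n'[OF u, unfolded n_def]]
      unfolding n_def .
    \<comment> \<open>Both sides of the curvature relation carry the factor \<open>4 p\<^sup>2 \<rho>\<^sup>2\<close>.\<close>
    note rel = curvature_ratio_relation[OF ratio q a k dX dN nz]
    note forms = contour_forms[OF x_eq[OF u] refl y'_eq[OF u]]
    have "T' u \<noteq> 0"
      using rel(2) unfolding Nv Nu forms by auto
    moreover have "(1 - k\<^sup>2) * (2 * p * \<rho> u * ((1 + (T u)\<^sup>2) * z' u - T' u * y u))\<^sup>2 =
      4 * ((\<rho> u)\<^sup>2 * T' u) * - (p\<^sup>2 * (1 + (T u)\<^sup>2) * (T' u + 4 * y u * z' u))"
      using rel(1) unfolding Xv Xu Nv Nu forms .
    then have "(4 * p\<^sup>2 * (\<rho> u)\<^sup>2) * ((1 - k\<^sup>2) * ((1 + (T u)\<^sup>2) * z' u - T' u * y u)\<^sup>2) =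
      (4 * p\<^sup>2 * (\<rho> u)\<^sup>2) * - (T' u * (1 + (T u)\<^sup>2) * (T' u + 4 * y u * z' u))"
      by algebra
    moreover have "4 * p\<^sup>2 * (\<rho> u)\<^sup>2 \<noteq> 0" using p \<rho>_pos[of u] by simp
    ultimately show ?thesis by (meson mult_left_cancel)
  qed
  have "continuous_on J z'"
    unfolding z'_def
    by (intro continuous_intros C1_differentiable_imp_continuous_on[OF d_C1] \<phi>'(2)) (use p in auto)
  then have "contour_ode k J T y z T' z'"
    using J T' y_deriv y'_eq z_deriv curv by unfold_locales auto
  moreover have "c u = (2 * p) *\<^sub>R helical_motion (1 / 2) (\<phi> u) (vector [T u / 2, y u, z u])"
    if "u \<in> J" for u
  proof -
    have e1: "2 * p * x u = c u $ 1 * cos (\<phi> u) + c u $ 2 * sin (\<phi> u)" using p by (simp add: x_def)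
    have e2: "2 * p * y u = c u $ 2 * cos (\<phi> u) - c u $ 1 * sin (\<phi> u)" using p by (simp add: y_def)
    have e3: "2 * p * z u = c u $ 3 - p * \<phi> u" using p by (simp add: z_def field_simps)
    have "2 * p * (x u * cos (\<phi> u) - y u * sin (\<phi> u)) = c u $ 1"
      using e1 e2 sin_cos_squared_add[of "\<phi> u"] by algebra
    moreover have "2 * p * (x u * sin (\<phi> u) + y u * cos (\<phi> u)) = c u $ 2"
      using e1 e2 sin_cos_squared_add[of "\<phi> u"] by algebra
    moreover have "2 * p * (z u + 1 / 2 * \<phi> u) = c u $ 3" using e3 by (simp add: algebra_simps)
    ultimately show ?thesis
      unfolding x_eq[OF that, symmetric] vector3_eq_iff
      by (simp add: helical_motion_components)
  qed
  ultimately show ?thesis using that[OF \<phi>_C1] by blast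
qed

section \<open>Integration of the contour equation\<close>

context contour_ode
begin

text \<open>\<open>T'\<close> has constant sign; multiplying by it avoids the distinction between increasing and
  decreasing \<open>T\<close>.\<close>

lemma T_monotone:
  assumes "u \<in> J" "v \<in> J" "u \<noteq> v"
  shows "(v - u) * T' v * (T v - T u) > 0"
proof -
  obtain x where x: "x \<in> J" "T v - T u = (v - u) * T' x"
    using mean_value_on_interval[OF connected_J T_deriv assms] by blast
  have "T' v * T' x > 0"
    using nonzero_constant_sign[OF connected_J T'_cont T'_nz] assms(2) x(1)
    by (auto intro: mult_pos_pos mult_neg_neg)
  moreover have "(v - u) * T' v * (T v - T u) = (v - u)\<^sup>2 * (T' v * T' x)"
    unfolding x(2) by algebra
  moreover have "(v - u)\<^sup>2 > 0" using assms(3) by simp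
  ultimately show ?thesis by (simp only: mult_pos_pos)
qed

lemma side_connected:
  assumes "\<epsilon> \<in> {1, - 1}"
  shows "connected {u \<in> J. \<epsilon> * T u > 0}"
proof -
  have "c \<in> J \<and> \<epsilon> * T c > 0" if ab: "a \<in> J" "\<epsilon> * T a > 0" "b \<in> J" "\<epsilon> * T b > 0" "a \<le> c" "c \<le> b" for a b c
  proof (cases "a = c \<or> c = b")
    case True
    then show ?thesis using ab by auto
  next
    case False
    then have less: "a < c" "c < b" using ab by auto
    have c: "c \<in> J" using connected_contains_Icc[OF connected_J ab(1,3)] ab by auto
    have "T' c > 0 \<and> T' b > 0 \<or> T' c < 0 \<and> T' b < 0"
      using nonzero_constant_sign[OF connected_J T'_cont T'_nz] c ab(3) by auto
    moreover have "(c - a) * (T' c * (T c - T a)) > 0" "(b - c) * (T' b * (T b - T c)) > 0"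
      using T_monotone[of a c] T_monotone[of c b] ab c less by (auto simp: mult.assoc)
    then have "T' c * (T c - T a) > 0" "T' b * (T b - T c) > 0"
      using less by (auto simp: zero_less_mult_iff)
    ultimately have "T a < T c \<and> T c < T b \<or> T b < T c \<and> T c < T a"
      by (auto simp: zero_less_mult_iff)
    then show ?thesis using c ab(2,4) assms by auto
  qed
  then have "is_interval {u \<in> J. \<epsilon> * T u > 0}"
    unfolding is_interval_1 by blast
  then show ?thesis by (simp add: is_interval_connected_1)
qed

text \<open>With \<open>A = (1 + T\<^sup>2) dz/dT\<close> this is \<open>A - y\<close>, so that \<open>gap + 2 y\<close> is \<open>A + y\<close>.\<close>

definition gap :: "real \<Rightarrow> real" where
  "gap u = (1 + (T u)\<^sup>2) * z' u / T' u - y u"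

lemma w2_pos: "1 + (T u)\<^sup>2 > 0"
  by (simp add: add_pos_nonneg)

lemma gap_eq: "u \<in> J \<Longrightarrow> (1 + (T u)\<^sup>2) * z' u = T' u * (gap u + y u)"
  using T'_nz[of u] by (simp add: gap_def)

text \<open>For fixed \<open>T\<close> the curvature equation is a hyperbola in the coordinates \<open>A + y\<close>, \<open>A - y\<close>, which
  does not meet the line \<open>A = y\<close>. Hence the solution stays on one branch.\<close>

lemma gap_conic:
  assumes "u \<in> J"
  shows "(gap u + 2 * y u)\<^sup>2 + (1 + (T u)\<^sup>2) = k\<^sup>2 * (gap u)\<^sup>2"
proof -
  have "(T' u)\<^sup>2 * ((gap u + 2 * y u)\<^sup>2 + (1 + (T u)\<^sup>2)) = (T' u)\<^sup>2 * (k\<^sup>2 * (gap u)\<^sup>2)"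
    using curvature[OF assms] gap_eq[OF assms] by algebra
  then show ?thesis using T'_nz[OF assms] by simp
qed

lemma gap_nz: "u \<in> J \<Longrightarrow> gap u \<noteq> 0"
  using gap_conic[of u] w2_pos[of u] by (auto simp: add_nonneg_eq_0_iff)

lemma y_cont: "continuous_on J y"
  by (rule DERIV_continuous_on[OF has_field_derivative_at_within[OF y_deriv]])

lemma T_cont: "continuous_on J T"
  by (rule DERIV_continuous_on[OF has_field_derivative_at_within[OF T_deriv]])

lemma gap_cont: "continuous_on J gap"
  unfolding gap_def using T'_nz
  by (intro continuous_intros T_cont y_cont T'_cont z'_cont) auto

lemma gap_sign: "(\<forall>u\<in>J. gap u > 0) \<or> (\<forall>u\<in>J. gap u < 0)"
  by (rule nonzero_constant_sign[OF connected_J gap_cont gap_nz])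

text \<open>The normal is orthogonal to the first axis in two positions, which differ by a half-turn about
  the helical axis. Passing to the other one exchanges the branches of the hyperbola; the height
  changes by \<open>pi / 2\<close> because the scaled motion has pitch \<open>1 / 2\<close>.\<close>

lemma half_turn:
  "contour_ode k J (\<lambda>u. - T u) (\<lambda>u. - y u) (\<lambda>u. z u - pi / 2) (\<lambda>u. - T' u) z'"
proof unfold_locales
  fix u assume u: "u \<in> J"
  show "((\<lambda>u. - y u) has_real_derivative - T u * z' u) (at u)"
    using y_deriv[OF u] by (auto intro!: derivative_eq_intros)
  show "((\<lambda>u. z u - pi / 2) has_real_derivative z' u) (at u)"
    using z_deriv[OF u] by (auto intro!: derivative_eq_intros)
  show "(1 - k\<^sup>2) * ((1 + (- T u)\<^sup>2) * z' u - - T' u * - y u)\<^sup>2 =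
      - (- T' u * (1 + (- T u)\<^sup>2) * (- T' u + 4 * - y u * z' u))"
    using curvature[OF u] by algebra
qed (auto intro!: derivative_intros continuous_intros open_J connected_J T_deriv T'_cont z'_cont T'_nz)

end

text \<open>The branch \<open>A > y\<close> is the one that carries the profiles.\<close>

locale oriented_contour_ode = contour_ode +
  assumes k_pos: "k > 0" and gap_pos: "\<And>u. u \<in> J \<Longrightarrow> gap u > 0"
begin

definition W :: "real \<Rightarrow> real" where "W u = sqrt (1 + (T u)\<^sup>2)"

lemma W_pos: "W u > 0" and W_sq: "(W u)\<^sup>2 = 1 + (T u)\<^sup>2"
  using w2_pos[of u] by (auto simp: W_def)

text \<open>The rational parameter of the branch, determined by \<open>W \<sigma> = k (A - y) + (A + y)\<close> and
  \<open>W / \<sigma> = k (A - y) - (A + y)\<close>; these are the two factors of the equation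
  \<open>k\<^sup>2 (A - y)\<^sup>2 - (A + y)\<^sup>2 = W\<^sup>2\<close> of the hyperbola.\<close>

definition \<sigma> :: "real \<Rightarrow> real" where
  "\<sigma> u = (k * gap u + (gap u + 2 * y u)) / W u"

lemma \<sigma>_W:
  assumes "u \<in> J"
  shows "\<sigma> u > 0" and "W u * \<sigma> u = k * gap u + (gap u + 2 * y u)"
    and "W u / \<sigma> u = k * gap u - (gap u + 2 * y u)"
proof -
  define P where "P = k * gap u + (gap u + 2 * y u)"
  define Q where "Q = k * gap u - (gap u + 2 * y u)"
  have PQ: "P * Q = (W u)\<^sup>2"
    unfolding W_sq P_def Q_def using gap_conic[OF assms] by algebra
  have "P + Q > 0" unfolding P_def Q_def using gap_pos[OF assms] k_pos by simp
  moreover have "P * Q > 0" using PQ W_pos[of u] by simp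
  ultimately have P: "P > 0" by (smt (verit) mult_neg_neg zero_less_mult_iff)
  show "\<sigma> u > 0" and P_eq: "W u * \<sigma> u = k * gap u + (gap u + 2 * y u)"
    using P W_pos[of u] by (simp_all add: \<sigma>_def P_def)
  have "\<sigma> u = P / W u" by (simp add: \<sigma>_def P_def)
  then have "W u / \<sigma> u = (W u)\<^sup>2 / P" by (simp add: power2_eq_square)
  then have "W u / \<sigma> u = Q" unfolding PQ[symmetric] using P by simp
  then show "W u / \<sigma> u = k * gap u - (gap u + 2 * y u)" by (simp add: Q_def)
qed

lemma y_\<sigma>:
  assumes "u \<in> J"
  shows "y u / W u = ((k - 1) * (\<sigma> u)\<^sup>2 - (k + 1)) / (4 * k * \<sigma> u)"
proof -
  note \<sigma> = \<sigma>_W[OF assms]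
  have "W u * ((k - 1) * (\<sigma> u)\<^sup>2 - (k + 1)) = \<sigma> u * ((k - 1) * (W u * \<sigma> u) - (k + 1) * (W u / \<sigma> u))"
    using \<sigma>(1) by (simp add: field_simps power2_eq_square)
  also have "\<dots> = \<sigma> u * (4 * k * y u)"
    unfolding \<sigma>(2,3) by algebra
  finally show ?thesis using \<sigma>(1) W_pos[of u] k_pos by (simp add: field_simps)
qed

lemma gap_\<sigma>:
  assumes "u \<in> J"
  shows "2 * k * gap u * \<sigma> u = W u * ((\<sigma> u)\<^sup>2 + 1)"
proof -
  note \<sigma> = \<sigma>_W[OF assms]
  have "W u * ((\<sigma> u)\<^sup>2 + 1) = \<sigma> u * (W u * \<sigma> u + W u / \<sigma> u)"
    using \<sigma>(1) by (simp add: field_simps power2_eq_square)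
  also have "\<dots> = 2 * k * gap u * \<sigma> u" unfolding \<sigma>(2,3) by algebra
  finally show ?thesis ..
qed

lemma W_deriv: "u \<in> J \<Longrightarrow> (W has_real_derivative T u * T' u / W u) (at u)"
  unfolding W_def using w2_pos[of u]
  by (auto intro!: derivative_eq_intros T_deriv simp: field_simps)

lemma y_W_deriv:
  assumes "u \<in> J"
  shows "((\<lambda>u. y u / W u) has_real_derivative T u * T' u * (gap u / W u ^ 3)) (at u)"
proof -
  have "((\<lambda>u. y u / W u) has_real_derivative
      (T u * z' u * W u - y u * (T u * T' u / W u)) / (W u * W u)) (at u)"
    using W_pos[of u] by (intro DERIV_divide y_deriv W_deriv assms) auto
  moreover have "(T u * z' u * W u - y u * (T u * T' u / W u)) / (W u * W u)
      = T u * ((W u)\<^sup>2 * z' u - T' u * y u) / W u ^ 3"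
    using W_pos[of u] by (simp add: field_simps power2_eq_square power3_eq_cube)
  moreover have "(W u)\<^sup>2 * z' u - T' u * y u = T' u * gap u"
    unfolding W_sq gap_eq[OF assms] by algebra
  ultimately show ?thesis by (simp add: mult.assoc)
qed

lemma \<sigma>_cont: "continuous_on J \<sigma>"
proof -
  have "continuous_on J W"
    by (rule DERIV_continuous_on[OF has_field_derivative_at_within[OF W_deriv]])
  then show ?thesis unfolding \<sigma>_def
    using W_pos by (intro continuous_intros gap_cont y_cont) (auto simp: less_imp_neq[symmetric])
qed

text \<open>The parameter \<open>\<sigma>\<close> is so far only continuous, since its definition involves \<open>z'\<close>. But \<open>y / W\<close> is
  differentiable and a function of \<open>\<sigma>\<close>, whose derivative has the factor
  \<open>(k - 1) \<sigma>\<^sup>2 + (k + 1)\<close>. For \<open>k < 1\<close> this factor has a zero, at which that function attains its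
  maximum over the positive numbers. The curve cannot pass there: \<open>y / W\<close> increases strictly
  with \<open>\<bar>T\<bar>\<close>, and near any parameter there are others with larger \<open>\<bar>T\<bar>\<close>.\<close>

lemma \<sigma>_regular:
  assumes u0: "u0 \<in> J"
  shows "(k - 1) * (\<sigma> u0)\<^sup>2 + (k + 1) \<noteq> 0"
proof
  assume crit: "(k - 1) * (\<sigma> u0)\<^sup>2 + (k + 1) = 0"
  define s0 where "s0 = \<sigma> u0"
  define \<eta> where "\<eta> = (\<lambda>u. y u / W u)"
  have s0: "s0 > 0" using \<sigma>_W(1)[OF u0] by (simp add: s0_def)
  have k1: "k + 1 = (1 - k) * s0\<^sup>2" using crit unfolding s0_def by algebra
  then have "k < 1" using k_pos s0 by (smt (verit) mult_nonpos_nonneg zero_le_power2)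
  have max: "\<eta> u \<le> \<eta> u0" if u: "u \<in> J" for u
  proof -
    define s where "s = \<sigma> u"
    have s: "s > 0" using \<sigma>_W(1)[OF u] by (simp add: s_def)
    have "\<eta> u0 - \<eta> u = (1 - k) * (s - s0)\<^sup>2 / (4 * k * s)"
      unfolding \<eta>_def y_\<sigma>[OF u] y_\<sigma>[OF u0] k1 s_def[symmetric] s0_def[symmetric]
      using s s0 k_pos by (simp add: field_simps power2_eq_square)
    also have "\<dots> \<ge> 0" using \<open>k < 1\<close> k_pos s by simp
    finally show ?thesis by simp
  qed
  have \<eta>': "(\<eta> has_real_derivative T u * T' u * (gap u / W u ^ 3)) (at u)" if "u \<in> J" for u
    unfolding \<eta>_def using that by (rule y_W_deriv)
  have ratio_pos: "gap u / W u ^ 3 > 0" if "u \<in> J" for u using gap_pos[OF that] W_pos[of u] by simp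
  \<comment> \<open>An interior maximum of \<open>\<eta>\<close> forces \<open>T = 0\<close>, but there \<open>\<bar>T\<bar>\<close> is minimal, and \<open>\<eta>\<close> increases
    to the right of it.\<close>
  obtain e where e: "e > 0" "ball u0 e \<subseteq> J" using open_J u0 open_contains_ball by blast
  have "T u0 * T' u0 * (gap u0 / W u0 ^ 3) = 0"
    by (rule DERIV_local_max[OF \<eta>'[OF u0] e(1)])
      (use max e(2) in \<open>auto simp: subset_iff dist_real_def\<close>)
  then have T0: "T u0 = 0" using T'_nz[OF u0] ratio_pos[OF u0] by auto
  define u where "u = u0 + e / 2"
  have u: "u \<in> J" "u0 \<noteq> u" "u0 < u" using e by (auto simp: u_def subset_iff dist_real_def)
  obtain x where x: "x \<in> J" "(u - u0) * (x - u0) > 0"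
      "\<eta> u - \<eta> u0 = (u - u0) * (T x * T' x * (gap x / W x ^ 3))"
    using mean_value_on_interval[OF connected_J \<eta>' u0 u(1,2)] by blast
  have x_gt: "x > u0" using x(2) u(3) by (simp add: zero_less_mult_iff)
  have "(x - u0) * T' x * (T x - T u0) > 0"
    using T_monotone[OF u0 x(1)] x_gt by simp
  then have "(x - u0) * (T x * T' x) > 0" by (simp add: T0 mult_ac)
  then have "T x * T' x > 0" by (rule zero_less_mult_pos) (use x_gt in simp)
  then have "T x * T' x * (gap x / W x ^ 3) > 0" using ratio_pos[OF x(1)] by (rule mult_pos_pos)
  then have "\<eta> u - \<eta> u0 > 0" unfolding x(3) using u(3) by (simp only: mult_pos_pos diff_gt_0_iff_gt)
  then show False using max[OF u(1)] by simp
qed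

definition \<sigma>' :: "real \<Rightarrow> real" where
  "\<sigma>' u = T u * T' u * (2 * \<sigma> u * ((\<sigma> u)\<^sup>2 + 1)) / ((1 + (T u)\<^sup>2) * ((k - 1) * (\<sigma> u)\<^sup>2 + (k + 1)))"

text \<open>Differences of \<open>y / W\<close> are the differences of \<open>\<sigma>\<close> times a continuous factor \<open>q\<close>, which by
  regularity does not vanish; dividing by it transfers differentiability to \<open>\<sigma>\<close>.\<close>

lemma \<sigma>_deriv:
  assumes u: "u \<in> J"
  shows "(\<sigma> has_real_derivative \<sigma>' u) (at u)"
proof -
  define \<eta> where "\<eta> = (\<lambda>u. y u / W u)"
  define q where "q v = ((k - 1) * (\<sigma> u * \<sigma> v) + (k + 1)) / (4 * k * (\<sigma> u * \<sigma> v))" for v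
  have \<sigma>u: "\<sigma> u > 0" using \<sigma>_W(1)[OF u] .
  have J_ev: "eventually (\<lambda>v. v \<in> J) (at u)"
    using open_J u by (rule eventually_at_in_open')
  have \<sigma>_lim: "(\<sigma> \<longlongrightarrow> \<sigma> u) (at u)"
    using \<sigma>_cont open_J u continuous_on_eq_continuous_at isContD by blast
  have q_lim: "(q \<longlongrightarrow> q u) (at u)"
    unfolding q_def using \<sigma>u k_pos by (intro tendsto_intros \<sigma>_lim) auto
  have q_nz: "q u \<noteq> 0"
    using \<sigma>_regular[OF u] \<sigma>u k_pos by (simp add: q_def power2_eq_square)
  have "((\<lambda>v. (\<eta> v - \<eta> u) / (v - u)) \<longlongrightarrow> T u * T' u * (gap u / W u ^ 3)) (at u)"
    using y_W_deriv[OF u] unfolding has_field_derivative_iff \<eta>_def .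
  then have lim: "((\<lambda>v. (\<eta> v - \<eta> u) / (v - u) / q v) \<longlongrightarrow> T u * T' u * (gap u / W u ^ 3) / q u) (at u)"
    by (intro tendsto_divide q_lim q_nz)
  have \<eta>_diff: "\<eta> v - \<eta> u = (\<sigma> v - \<sigma> u) * q v" if v: "v \<in> J" for v
    unfolding \<eta>_def y_\<sigma>[OF u] y_\<sigma>[OF v] q_def
    using \<sigma>u \<sigma>_W(1)[OF v] k_pos by (simp add: field_simps power2_eq_square)
  have "eventually (\<lambda>v. (\<eta> v - \<eta> u) / (v - u) / q v = (\<sigma> v - \<sigma> u) / (v - u)) (at u)"
    using J_ev tendsto_imp_eventually_ne[OF q_lim q_nz]
    by eventually_elim (simp add: \<eta>_diff)
  then have "((\<lambda>v. (\<sigma> v - \<sigma> u) / (v - u)) \<longlongrightarrow> T u * T' u * (gap u / W u ^ 3) / q u) (at u)"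
    using lim by (rule Lim_transform_eventually[rotated])
  moreover have "T u * T' u * (gap u / W u ^ 3) / q u = \<sigma>' u"
  proof -
    have gap: "gap u = W u * ((\<sigma> u)\<^sup>2 + 1) / (2 * k * \<sigma> u)"
      using gap_\<sigma>[OF u] \<sigma>u k_pos by (simp add: field_simps)
    have gap_W: "gap u / W u ^ 3 = ((\<sigma> u)\<^sup>2 + 1) / (2 * k * \<sigma> u * (1 + (T u)\<^sup>2))"
      unfolding gap W_sq[symmetric] using W_pos[of u]
      by (simp add: power2_eq_square power3_eq_cube)
    have q: "q u = ((k - 1) * (\<sigma> u)\<^sup>2 + (k + 1)) / (4 * k * (\<sigma> u)\<^sup>2)"
      by (simp add: q_def power2_eq_square)
    have quotient: "t * (g / (2 * k * s * V)) / (N / (4 * k * s\<^sup>2)) = t * (2 * s * g) / (V * N)"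
      if "s > 0" "V > 0" "N \<noteq> 0" for t g s V N :: real
      using that k_pos by (simp add: field_simps power2_eq_square)
    show ?thesis
      unfolding \<sigma>'_def gap_W q by (rule quotient[OF \<sigma>u w2_pos \<sigma>_regular[OF u]])
  qed
  ultimately show ?thesis unfolding has_field_derivative_iff by simp
qed

lemma \<sigma>_C1: "\<sigma> C1_differentiable_on J"
proof -
  have "continuous_on J \<sigma>'"
    unfolding \<sigma>'_def using \<sigma>_regular w2_pos
    by (intro continuous_intros \<sigma>_cont T_cont T'_cont) (auto simp: less_imp_neq[symmetric])
  then show ?thesis
    unfolding C1_real_iff using \<sigma>_deriv by (intro exI conjI ballI)
qed

text \<open>The formula for \<open>\<sigma>'\<close> is a separated equation between \<open>1 + T\<^sup>2\<close> and \<open>\<sigma>\<close>. The function \<open>L\<close> is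
  its first integral, and \<open>2 C\<close> is the exponential of its constant value.\<close>

lemma radicand_constant:
  assumes "J \<noteq> {}"
  shows "\<exists>C > 0. \<forall>u\<in>J. radicand k C (\<sigma> u) = 1 + (T u)\<^sup>2"
proof -
  define L where "L u = ln (1 + (T u)\<^sup>2) + ln ((\<sigma> u)\<^sup>2 + 1) - (k + 1) * ln (\<sigma> u)" for u
  have L': "(L has_real_derivative 0) (at u)" if u: "u \<in> J" for u
  proof -
    define N where "N = (k - 1) * (\<sigma> u)\<^sup>2 + (k + 1)"
    have pos: "\<sigma> u > 0" "(\<sigma> u)\<^sup>2 + 1 > 0" "N \<noteq> 0"
      using \<sigma>_W(1)[OF u] \<sigma>_regular[OF u] by (auto simp: N_def add_nonneg_pos)
    have "(L has_real_derivative 2 * T u * T' u / (1 + (T u)\<^sup>2) + 2 * \<sigma> u * \<sigma>' u / ((\<sigma> u)\<^sup>2 + 1)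
        - (k + 1) * (\<sigma>' u / \<sigma> u)) (at u)"
      unfolding L_def using pos w2_pos[of u]
      by (auto intro!: derivative_eq_intros T_deriv u \<sigma>_deriv simp: field_simps)
    moreover have "2 * \<sigma> u * \<sigma>' u / ((\<sigma> u)\<^sup>2 + 1) - (k + 1) * (\<sigma>' u / \<sigma> u)
        = - (\<sigma>' u * N / (\<sigma> u * ((\<sigma> u)\<^sup>2 + 1)))"
    proof -
      have "x / V - y / s = (x * s - y * V) / (s * V)" if "s > 0" "V > 0" for x y s V :: real
        using that by (simp add: field_simps)
      from this[OF pos(1,2), of "2 * \<sigma> u * \<sigma>' u" "(k + 1) * \<sigma>' u"]
      have "2 * \<sigma> u * \<sigma>' u / ((\<sigma> u)\<^sup>2 + 1) - (k + 1) * (\<sigma>' u / \<sigma> u) =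
        (2 * \<sigma> u * \<sigma>' u * \<sigma> u - (k + 1) * \<sigma>' u * ((\<sigma> u)\<^sup>2 + 1)) / (\<sigma> u * ((\<sigma> u)\<^sup>2 + 1))"
        by simp
      moreover have "2 * \<sigma> u * \<sigma>' u * \<sigma> u - (k + 1) * \<sigma>' u * ((\<sigma> u)\<^sup>2 + 1) = - (\<sigma>' u * N)"
        unfolding N_def by algebra
      ultimately show ?thesis by simp
    qed
    moreover have "\<sigma>' u * N / (\<sigma> u * ((\<sigma> u)\<^sup>2 + 1)) = 2 * T u * T' u / (1 + (T u)\<^sup>2)"
    proof -
      have "t * t' * (2 * s * V) / (Y * N) * N / (s * V) = 2 * t * t' / Y"
        if "s > 0" "V > 0" "Y > 0" for t t' s V Y :: real
        using that pos(3) by (simp add: field_simps)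
      from this[OF pos(1,2) w2_pos[of u]] show ?thesis unfolding \<sigma>'_def N_def[symmetric] .
    qed
    ultimately show ?thesis by (simp add: algebra_simps)
  qed
  obtain u0 where u0: "u0 \<in> J" using assms by blast
  have "radicand k (exp (L u0) / 2) (\<sigma> u) = 1 + (T u)\<^sup>2" if u: "u \<in> J" for u
  proof -
    have pos: "\<sigma> u > 0" "(\<sigma> u)\<^sup>2 + 1 > 0" using \<sigma>_W(1)[OF u] by (auto simp: add_nonneg_pos)
    have "L u0 = L u" using zero_derivative_constant_on_interval[OF connected_J L' u0 u] .
    then have "exp (L u0) = (1 + (T u)\<^sup>2) * ((\<sigma> u)\<^sup>2 + 1) / \<sigma> u powr (k + 1)"
      using pos w2_pos[of u] by (simp add: L_def exp_diff exp_add powr_def)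
    then show ?thesis using pos by (simp add: radicand_def)
  qed
  then show ?thesis by (intro exI[of _ "exp (L u0) / 2"]) auto
qed

lemma profile_functions_\<sigma>:
  assumes "u \<in> J" "radicand k C (\<sigma> u) = 1 + (T u)\<^sup>2"
  shows "g_fun k C (\<sigma> u) = y u" and "t_fun k C (\<sigma> u) = \<bar>T u\<bar>"
proof -
  show "g_fun k C (\<sigma> u) = y u"
    unfolding g_fun_def assms(2) y_\<sigma>[OF assms(1), symmetric] W_def[symmetric]
    using W_pos[of u] by simp
  show "t_fun k C (\<sigma> u) = \<bar>T u\<bar>" unfolding t_fun_def assms(2) by simp
qed

lemma \<sigma>'_nz:
  assumes "u \<in> J" "T u \<noteq> 0"
  shows "\<sigma>' u \<noteq> 0"
  using assms T'_nz[OF assms(1)] \<sigma>_W(1)[OF assms(1)] \<sigma>_regular[OF assms(1)] w2_pos[of u]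
  by (simp add: \<sigma>'_def add_nonneg_eq_0_iff less_imp_neq[symmetric])

end

section \<open>The profiles\<close>

lemma radicand_pos: "C > 0 \<Longrightarrow> s > 0 \<Longrightarrow> radicand k C s > 0"
  by (simp add: radicand_def add_nonneg_pos)

lemma radicand_deriv:
  assumes "s > 0"
  shows "(radicand k C has_real_derivative
    2 * C * ((k + 1) * s powr k * (s\<^sup>2 + 1) - s powr (k + 1) * (2 * s)) / (s\<^sup>2 + 1)\<^sup>2) (at s)"
proof -
  have "s\<^sup>2 + 1 \<noteq> 0" by (simp add: add_nonneg_eq_0_iff)
  then show ?thesis
    unfolding radicand_def using assms
    by (auto intro!: derivative_eq_intros simp: field_simps power2_eq_square)
qed

lemma continuous_on_radicand: "continuous_on {0<..} (radicand k C)"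
  by (rule DERIV_continuous_on[OF has_field_derivative_at_within[OF radicand_deriv]]) simp

lemma open_I_dom: "open (I_dom k C)"
proof -
  have "I_dom k C = {0<..} \<inter> radicand k C -` {1<..}" by (auto simp: I_dom_def)
  then show ?thesis
    using continuous_open_preimage[OF continuous_on_radicand, of "{1<..}" k C] by simp
qed

lemma g_fun_C1:
  assumes "C > 0" "k > 0"
  shows "g_fun k C C1_differentiable_on {0<..}"
proof -
  have rad: "radicand k C C1_differentiable_on {0<..}"
    unfolding C1_real_iff
  proof (intro exI conjI ballI)
    show "(radicand k C has_real_derivative
      2 * C * ((k + 1) * s powr k * (s\<^sup>2 + 1) - s powr (k + 1) * (2 * s)) / (s\<^sup>2 + 1)\<^sup>2) (at s)"
      if "s \<in> {0<..}" for s using that radicand_deriv by simp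
    show "continuous_on {0<..}
      (\<lambda>s. 2 * C * ((k + 1) * s powr k * (s\<^sup>2 + 1) - s powr (k + 1) * (2 * s)) / (s\<^sup>2 + 1)\<^sup>2)"
      by (intro continuous_intros) (auto simp: add_nonneg_eq_0_iff)
  qed
  have "(\<lambda>s. ((k - 1) * (s * s) - (k + 1)) * inverse (4 * k * s) * sqrt (radicand k C s))
      C1_differentiable_on {0<..}"
    using assms radicand_pos
    by (intro C1_differentiable_on_mult C1_differentiable_on_diff C1_differentiable_on_const
        C1_differentiable_on_ident C1_inverse C1_sqrt rad) auto
  then show ?thesis
    unfolding g_fun_def[abs_def] by (simp only: divide_inverse power2_eq_square)
qed

lemma profile_antiderivative_exists:
  assumes "C > 0" "k > 0"
  shows "\<exists>Z. is_profile_antiderivative k C Z"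
proof -
  obtain g' where g': "\<forall>s\<in>{0<..}. (g_fun k C has_real_derivative g' s) (at s)" "continuous_on {0<..} g'"
    using g_fun_C1[OF assms] unfolding C1_real_iff by blast
  have sub: "I_dom k C \<subseteq> {0<..}" by (auto simp: I_dom_def)
  have "continuous_on (I_dom k C) (\<lambda>s. g' s / t_fun k C s)"
    unfolding t_fun_def
    by (intro continuous_intros continuous_on_subset[OF g'(2) sub]
        continuous_on_subset[OF continuous_on_radicand sub]) (auto simp: I_dom_def)
  then have "\<exists>Z. \<forall>s\<in>I_dom k C. (Z has_real_derivative g' s / t_fun k C s) (at s)"
    by (rule continuous_antiderivative_open[OF open_I_dom])
  moreover have "deriv (g_fun k C) s = g' s" if "s \<in> I_dom k C" for s
    using g'(1) sub that by (blast intro: DERIV_imp_deriv)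
  ultimately show ?thesis unfolding is_profile_antiderivative_def by auto
qed

context oriented_contour_ode
begin

text \<open>Both \<open>g\<close> composed with \<open>\<sigma>\<close> and \<open>y\<close> have the derivative \<open>T z'\<close>, and \<open>t\<close> equals \<open>\<bar>T\<bar>\<close>. So the
  quotient \<open>g' / t\<close>, transported to \<open>u\<close>, is \<open>z'\<close> up to the sign of \<open>T\<close>, which is the sign that
  distinguishes the two profiles.\<close>

lemma height_along_profile:
  assumes u: "u \<in> J" "T u \<noteq> 0" and C: "C > 0"
    and rad: "\<And>u. u \<in> J \<Longrightarrow> radicand k C (\<sigma> u) = 1 + (T u)\<^sup>2"
    and Z: "is_profile_antiderivative k C Z"
  shows "((\<lambda>u. Z (\<sigma> u)) has_real_derivative sgn (T u) * z' u) (at u)"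
proof -
  have \<sigma>: "\<sigma> u \<in> I_dom k C" using \<sigma>_W(1)[OF u(1)] rad[OF u(1)] u(2) by (simp add: I_dom_def)
  have g: "(g_fun k C has_real_derivative deriv (g_fun k C) (\<sigma> u)) (at (\<sigma> u))"
    using g_fun_C1[OF C k_pos] \<sigma>_W(1)[OF u(1)] unfolding C1_real_iff
    by (metis DERIV_imp_deriv greaterThan_iff)
  have "((\<lambda>u. g_fun k C (\<sigma> u)) has_real_derivative deriv (g_fun k C) (\<sigma> u) * \<sigma>' u) (at u)"
    by (rule DERIV_chain2[OF g \<sigma>_deriv[OF u(1)]])
  moreover have "((\<lambda>u. g_fun k C (\<sigma> u)) has_real_derivative T u * z' u) (at u)"
    by (rule has_field_derivative_transform_within_open[OF y_deriv[OF u(1)] open_J u(1)])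
      (use profile_functions_\<sigma>(1) rad in auto)
  ultimately have g': "deriv (g_fun k C) (\<sigma> u) * \<sigma>' u = T u * z' u" by (rule DERIV_unique)
  have "((\<lambda>u. Z (\<sigma> u)) has_real_derivative
      deriv (g_fun k C) (\<sigma> u) / t_fun k C (\<sigma> u) * \<sigma>' u) (at u)"
    using Z \<sigma> unfolding is_profile_antiderivative_def
    by (blast intro: DERIV_chain2 \<sigma>_deriv[OF u(1)])
  moreover have "deriv (g_fun k C) (\<sigma> u) / t_fun k C (\<sigma> u) * \<sigma>' u = sgn (T u) * z' u"
    unfolding profile_functions_\<sigma>(2)[OF u(1) rad[OF u(1)]] using u(2) g'
    by (simp add: sgn_if abs_if field_simps)
  ultimately show ?thesis by simp
qed

lemma height_constant_on_side:
  assumes \<epsilon>: "\<epsilon> \<in> {1, - 1}" and C: "C > 0"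
    and rad: "\<And>u. u \<in> J \<Longrightarrow> radicand k C (\<sigma> u) = 1 + (T u)\<^sup>2"
    and Z: "is_profile_antiderivative k C Z"
  shows "\<exists>b. \<forall>u\<in>J. \<epsilon> * T u > 0 \<longrightarrow> z u = \<epsilon> * (Z (\<sigma> u) + b)"
proof (cases "{u \<in> J. \<epsilon> * T u > 0} = {}")
  case False
  let ?S = "{u \<in> J. \<epsilon> * T u > 0}"
  obtain u0 where u0: "u0 \<in> ?S" using False by blast
  have "((\<lambda>u. \<epsilon> * z u - Z (\<sigma> u)) has_real_derivative 0) (at u)" if "u \<in> ?S" for u
  proof -
    have u: "u \<in> J" "T u \<noteq> 0" "sgn (T u) = \<epsilon>" using that \<epsilon> by (auto simp: sgn_if)
    have "((\<lambda>u. \<epsilon> * z u - Z (\<sigma> u)) has_real_derivative \<epsilon> * z' u - sgn (T u) * z' u) (at u)"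
      by (intro DERIV_diff DERIV_cmult z_deriv height_along_profile[OF u(1,2) C rad Z] u(1))
    then show ?thesis using u(3) by simp
  qed
  then have "\<epsilon> * z u - Z (\<sigma> u) = \<epsilon> * z u0 - Z (\<sigma> u0)" if "u \<in> ?S" for u
    using zero_derivative_constant_on_interval[OF side_connected[OF \<epsilon>]] that u0 by blast
  then have "z u = \<epsilon> * (Z (\<sigma> u) + (\<epsilon> * z u0 - Z (\<sigma> u0)))" if "u \<in> J" "\<epsilon> * T u > 0" for u
    using that \<epsilon> by (auto simp: algebra_simps)
  then show ?thesis by blast
qed auto

end

lemma helical_motion_compose:
  "helical_motion p v ((2 * p) *\<^sub>R helical_motion (1 / 2) w x) = (2 * p) *\<^sub>R helical_motion (1 / 2) (v + w) x"
  unfolding vector3_eq_iff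
  by (simp add: helical_motion_components cos_add sin_add algebra_simps)

text \<open>The side of the exceptional helix on which \<open>T > 0\<close> is covered by the first profile and the side
  on which \<open>T < 0\<close> by the second one. Since each profile is used on one side only, the additive
  constants \<open>b0\<close> and \<open>b1\<close> of the two antiderivatives can be adapted independently.\<close>

lemma oriented_parametrization:
  assumes "oriented_contour_ode k J T y z T' z'" and J: "J \<noteq> {}" and \<phi>: "\<phi> C1_differentiable_on J"
    and c: "\<And>u. u \<in> J \<Longrightarrow>
      c u = (2 * p) *\<^sub>R helical_motion (1 / 2) (\<phi> u) (vector [T u / 2, y u, z u])"
  shows "\<exists>C > 0. I_dom k C \<noteq> {} \<and>
           (\<exists>Z. (\<forall>i\<in>{0, 1}. is_profile_antiderivative k C (Z i)) \<and>
                parametrized_by_profiles p J c k C Z)"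
proof -
  interpret oriented_contour_ode k J T y z T' z' by fact
  obtain C where C: "C > 0" and rad: "\<And>u. u \<in> J \<Longrightarrow> radicand k C (\<sigma> u) = 1 + (T u)\<^sup>2"
    using radicand_constant[OF J] by blast
  obtain Z0 where Z0: "is_profile_antiderivative k C Z0"
    using profile_antiderivative_exists[OF C k_pos] by blast
  obtain b0 where b0: "\<And>u. u \<in> J \<Longrightarrow> T u > 0 \<Longrightarrow> z u = Z0 (\<sigma> u) + b0"
    using height_constant_on_side[of 1, OF _ C rad Z0] by auto
  obtain b1 where b1: "\<And>u. u \<in> J \<Longrightarrow> T u < 0 \<Longrightarrow> z u = - (Z0 (\<sigma> u) + b1)"
    using height_constant_on_side[of "- 1", OF _ C rad Z0] by auto
  define Z where "Z i s = Z0 s + (if i = 0 then b0 else b1)" for i :: nat and s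
  define i :: "real \<Rightarrow> nat" where "i u = (if T u > 0 then 0 else 1)" for u
  define E where "E = {u \<in> J. T u = 0}"
  have Z: "is_profile_antiderivative k C (Z j)" for j
    using Z0 unfolding is_profile_antiderivative_def Z_def by (auto intro!: derivative_eq_intros)
  have E_eq: "u = v" if "u \<in> E" "v \<in> E" for u v
    using T_monotone[of u v] that by (cases "u = v") (auto simp: E_def)
  then obtain e where "E \<subseteq> {e}" by blast
  then have E: "finite E" "card E \<le> 1"
    using finite_subset card_mono[of "{e}" E] by auto
  have i_cont: "continuous_on (J - E) i"
  proof -
    have sides: "J - E = {u \<in> J. T u > 0} \<union> {u \<in> J. T u < 0}" by (auto simp: E_def)
    have op: "open {u \<in> J. T u > 0}" "open {u \<in> J. T u < 0}"
      using continuous_open_preimage[OF T_cont open_J, of "{0<..}"]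
        continuous_open_preimage[OF T_cont open_J, of "{..<0}"]
      by (simp_all add: vimage_def Int_def)
    show ?thesis unfolding sides
    proof (rule continuous_on_open_Un[OF op])
      show "continuous_on {u \<in> J. T u > 0} i"
        by (rule continuous_on_eq[OF continuous_on_const[of _ 0]]) (simp add: i_def)
      show "continuous_on {u \<in> J. T u < 0} i"
        by (rule continuous_on_eq[OF continuous_on_const[of _ 1]]) (simp add: i_def)
    qed
  qed
  have param: "helical_surface p c (v, u) =
      (2 * p) *\<^sub>R helical_motion (1 / 2) (v + \<phi> u) (profile k C (Z (i u)) (i u) (\<sigma> u))"
    if u: "u \<in> J" "T u \<noteq> 0" for u v
  proof -
    have "profile k C (Z (i u)) (i u) (\<sigma> u) = vector [T u / 2, y u, z u]"
      using profile_functions_\<sigma>[OF u(1) rad[OF u(1)]] b0[OF u(1)] b1[OF u(1)] u(2)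
      by (auto simp: profile_def i_def Z_def)
    then show ?thesis
      unfolding helical_surface_def by (simp add: c[OF u(1)] helical_motion_compose)
  qed
  have \<sigma>_I: "\<sigma> u \<in> I_dom k C" if "u \<in> J" "T u \<noteq> 0" for u
    using \<sigma>_W(1)[OF that(1)] rad[OF that(1)] that(2) by (simp add: I_dom_def)
  have "\<not> finite J" using J open_J finite_imp_not_open by blast
  then have "\<not> J \<subseteq> E" using E(1) finite_subset by blast
  then have "I_dom k C \<noteq> {}" using \<sigma>_I by (auto simp: E_def)
  moreover have "parametrized_by_profiles p J c k C Z"
    unfolding parametrized_by_profiles_def
  proof (rule exI[of _ \<phi>], rule exI[of _ \<sigma>], rule exI[of _ i], rule exI[of _ E],
      intro conjI ballI allI)
    show "deriv \<sigma> u \<noteq> 0" if "u \<in> J - E" for u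
      using that \<sigma>'_nz[of u] DERIV_imp_deriv[OF \<sigma>_deriv[of u]] by (auto simp: E_def)
  qed (use \<phi> \<sigma>_C1 E i_cont \<sigma>_I param rad \<sigma>_W(1) in \<open>auto simp: E_def i_def\<close>)
  ultimately show ?thesis using C Z by blast
qed

theorem theorem3p1:
  fixes p a k :: real and J :: "real set" and c :: "real \<Rightarrow> real^3"
  assumes "p \<noteq> 0"
    and "a \<notin> {0, 1, -1}"
    and "generating_curve p J c"
    and "constant_principal_curvature_ratio (helical_surface p c) (UNIV \<times> J) a"
    and "k = \<bar>(a - 1) / (a + 1)\<bar>"
  shows "\<exists>C > 0. I_dom k C \<noteq> {} \<and>
           (\<exists>Z. (\<forall>i\<in>{0, 1}. is_profile_antiderivative k C (Z i)) \<and>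
                parametrized_by_profiles p J c k C Z)"
proof -
  have a: "a \<noteq> 0" "a \<noteq> 1" "a \<noteq> - 1" using assms(2) by auto
  have a1: "a + 1 \<noteq> 0" using a(3) by (simp add: add_eq_0_iff2)
  have k: "k > 0" unfolding assms(5) zero_less_abs_iff using a(2) a1 by simp
  have J: "J \<noteq> {}" using assms(3) by (simp add: generating_curve_def)
  obtain \<phi> T y z T' z' where \<phi>: "\<phi> C1_differentiable_on J" and ode: "contour_ode k J T y z T' z'"
    and c: "\<And>u. u \<in> J \<Longrightarrow>
      c u = (2 * p) *\<^sub>R helical_motion (1 / 2) (\<phi> u) (vector [T u / 2, y u, z u])"
    using contour_frame[OF assms(1) a(1,3) assms(3-5)] by blast
  interpret contour_ode k J T y z T' z' by fact
  from gap_sign show ?thesis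
  proof
    assume "\<forall>u\<in>J. gap u > 0"
    then have "oriented_contour_ode k J T y z T' z'" using k by unfold_locales auto
    then show ?thesis using J \<phi> c by (rule oriented_parametrization)
  next
    assume neg: "\<forall>u\<in>J. gap u < 0"
    interpret turned: contour_ode k J "\<lambda>u. - T u" "\<lambda>u. - y u" "\<lambda>u. z u - pi / 2" "\<lambda>u. - T' u" z'
      by (rule half_turn)
    have "turned.gap u = - gap u" for u by (simp add: turned.gap_def gap_def)
    then have "oriented_contour_ode k J (\<lambda>u. - T u) (\<lambda>u. - y u) (\<lambda>u. z u - pi / 2) (\<lambda>u. - T' u) z'"
      using k neg by unfold_locales auto
    moreover have "(\<lambda>u. \<phi> u + pi) C1_differentiable_on J"
      by (intro C1_differentiable_on_add \<phi> C1_differentiable_on_const)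
    moreover have "c u = (2 * p) *\<^sub>R helical_motion (1 / 2) (\<phi> u + pi)
        (vector [- T u / 2, - y u, z u - pi / 2])" if "u \<in> J" for u
      unfolding c[OF that] vector3_eq_iff
      by (simp add: helical_motion_components algebra_simps)
    ultimately show ?thesis using oriented_parametrization J by blast
  qed
qed

end
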